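(* Let $\mathfrak{F}\subseteq\mathfrak{F}_{\mathrm{all}}$ satisfy $\mathfrak{F}\supseteq\mathfrak{F}_{\mathrm{AR}(2)}$. Suppose that the polynomial trend assumption holds: $X=(F,\tilde X)$, where $F$ is $n\times k_F$-dimensional ($1\le k_F\le k$) with $j$-th column $(1^{j-1},\ldots,n^{j-1})'$, where $\tilde X$ is an $n\times(k-k_F)$-dimensional matrix such that $X$ has rank $k$ ($\tilde X$ is the empty matrix if $k_F=k$), and the restriction matrix $R$ has a nonzero column $R_{\cdot i}$ for some $i\in\{1,\ldots,k_F\}$. Let $T$ be a nonsphericity-corrected F-type test statistic based on $\check\beta$ and $\check\Omega$, where $(\check\beta,\check\Omega,N)$ satisfies the estimator conditions with $N=\emptyset$. Furthermore, assume that $\check\Omega(y)$ is nonnegative definite for every $y\in\mathbb{R}^n$. Then $$\sup_{f\in\mathfrak{F}}P_{\mu_0,\sigma^2\Sigma(f)}(T\ge C)=1$$ holds for every critical value $C$, $-\infty<C<\infty$, for every $\mu_0\in\mathfrak{M}_0$, and for every $\sigma^2\in(0,\infty)$.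
   Context: Model: $n,k,q$ are positive integers with $1\le k<n$; $X\in\mathbb{R}^{n\times k}$ is a fixed matrix of rank $k$; $R\in\mathbb{R}^{q\times k}$ has rank $q\ge 1$; $r\in\mathbb{R}^q$. (One tests $R\beta=r$ in $\mathbf{Y}=X\beta+\mathbf{U}$, $\mathbf{U}\sim N(0,\sigma^2\Sigma(f))$, $0<\sigma^2<\infty$, $f\in\mathfrak{F}$.) $'$ is transpose, $\mathfrak{M}_0=\{X\beta:R\beta=r\}$. $P_{\mu,A}$ is the Gaussian measure on $\mathbb{R}^n$ with mean $\mu$ and covariance $A$; $P(T\ge C)$ means $P(\{y:T(y)\ge C\})$. $\lambda_{\mathbb{R}^n}$ is Lebesgue measure. Spectral densities: $\mathfrak{F}_{\mathrm{all}}$ is the set of all normalized spectral densities of real weakly stationary processes (nonnegative, even, integrable $f$ on $[-\pi,\pi]$ with $\int_{-\pi}^{\pi}f=1$); $\mathfrak{F}_{\mathrm{AR}(2)}$ is the subset of those corresponding to stationary autoregressive processes of order at most two; $\Sigma(f)=\left[\int_{-\pi}^{\pi}e^{-\iota(j-l)\omega}f(\omega)d\omega\right]_{j,l=1}^n$, $\iota$ the imaginary unit. Estimator conditions on $(\check\beta,\check\Omega,N)$: (i) $\check\beta:\mathbb{R}^n\setminus N\to\mathbb{R}^k$ and $\check\Omega:\mathbb{R}^n\setminus N\to\mathbb{R}^{q\times q}$ are well-defined and continuous on $\mathbb{R}^n\setminus N$, where $N$ is a closed $\lambda_{\mathbb{R}^n}$-null set, and $\check\Omega(y)$ is symmetric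 for every $y\in\mathbb{R}^n\setminus N$; (ii) $y\in\mathbb{R}^n\setminus N$ implies $\delta y+X\eta\in\mathbb{R}^n\setminus N$ for all $\delta\ne0$, $\eta\in\mathbb{R}^k$; (iii) $\check\beta(\delta y+X\eta)=\delta\check\beta(y)+\eta$ and $\check\Omega(\delta y+X\eta)=\delta^2\check\Omega(y)$ for all $y\in\mathbb{R}^n\setminus N$, $\delta\neq0$, $\eta\in\mathbb{R}^k$; (iv) $\check\Omega$ is $\lambda_{\mathbb{R}^n}$-almost everywhere nonsingular on $\mathbb{R}^n\setminus N$. Nonsphericity-corrected F-type test statistic: with $N^*=N\cup\{y\in\mathbb{R}^n\setminus N:\det\check\Omega(y)=0\}$, $T(y)=(R\check\beta(y)-r)'\check\Omega^{-1}(y)(R\check\beta(y)-r)$ for $y\in\mathbb{R}^n\setminus N^*$ and $T(y)=0$ for $y\in N^*$. *)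

theory Defs
  imports "HOL-Probability.Probability"
begin

text \<open>
  \<open>\<real>\<^sup>n\<close> is \<open>real ^ 'n\<close> with a finite linearly ordered index type, so that rows (time points)
  and regressors carry numbers \<open>1, 2, \<dots>\<close>; \<open>pos i\<close> is the number of the index \<open>i\<close>.
\<close>

definition pos :: "'i::{finite,linorder} \<Rightarrow> nat" where
  "pos i = card {..i}"

text \<open>
  The law of \<open>\<mu> + B Z\<close> with \<open>Z\<close> standard normal and \<open>B B' = A\<close>. For symmetric nonnegative
  definite \<open>A\<close> such a \<open>B\<close> exists, and the law does not depend on which one is chosen;
  singular \<open>A\<close> is allowed.
\<close>

definition gaussian_measure :: "real ^ 'n \<Rightarrow> real ^ 'n ^ 'n \<Rightarrow> (real ^ 'n) measure" where
  "gaussian_measure \<mu> A =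
     (let B = (SOME B :: real ^ 'n ^ 'n. B ** transpose B = A)
      in distr (\<Pi>\<^sub>M i\<in>(UNIV :: 'n set). density lborel std_normal_density) borel
           (\<lambda>z. \<mu> + B *v (\<chi> i. z i)))"

definition fourier_coeff :: "(real \<Rightarrow> real) \<Rightarrow> int \<Rightarrow> complex" where
  "fourier_coeff f h =
     (LINT \<omega>:{-pi..pi}|lebesgue. exp (- \<i> * of_int h * of_real \<omega>) * of_real (f \<omega>))"

text \<open>
  Functions on \<open>[-\<pi>, \<pi>]\<close> are represented as elements of \<^term>\<open>extensional {-pi..pi}\<close>, so that
  equality of functions is equality on \<open>[-\<pi>, \<pi>]\<close>.
\<close>

definition F_all :: "(real \<Rightarrow> real) set" where
  "F_all = {f \<in> extensional {-pi..pi}.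
      (\<forall>\<omega>\<in>{-pi..pi}. 0 \<le> f \<omega>) \<and>
      (\<forall>\<omega>\<in>{-pi..pi}. f (- \<omega>) = f \<omega>) \<and>
      set_integrable lebesgue {-pi..pi} f \<and>
      (LINT \<omega>:{-pi..pi}|lebesgue. f \<omega>) = 1}"

definition covariance :: "'a measure \<Rightarrow> ('a \<Rightarrow> real) \<Rightarrow> ('a \<Rightarrow> real) \<Rightarrow> real" where
  "covariance M U V =
     (LINT x|M. (U x - (LINT x|M. U x)) * (V x - (LINT x|M. V x)))"

definition weakly_stationary :: "'a measure \<Rightarrow> (int \<Rightarrow> 'a \<Rightarrow> real) \<Rightarrow> bool" where
  "weakly_stationary M Z \<longleftrightarrow>
     prob_space M \<and>
     (\<forall>t. Z t \<in> borel_measurable M \<and> integrable M (\<lambda>x. (Z t x)\<^sup>2)) \<and>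
     (\<forall>s t. (LINT x|M. Z s x) = (LINT x|M. Z t x)) \<and>
     (\<forall>s t h. covariance M (Z (s + h)) (Z s) = covariance M (Z (t + h)) (Z t))"

definition white_noise :: "'a measure \<Rightarrow> (int \<Rightarrow> 'a \<Rightarrow> real) \<Rightarrow> bool" where
  "white_noise M \<epsilon> \<longleftrightarrow>
     weakly_stationary M \<epsilon> \<and>
     (\<forall>t. (LINT x|M. \<epsilon> t x) = 0) \<and>
     (\<exists>v>0. \<forall>s t. covariance M (\<epsilon> s) (\<epsilon> t) = (if s = t then v else 0))"

definition has_spectral_density ::
    "'a measure \<Rightarrow> (int \<Rightarrow> 'a \<Rightarrow> real) \<Rightarrow> (real \<Rightarrow> real) \<Rightarrow> bool" where
  "has_spectral_density M Z f \<longleftrightarrow>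
     (\<forall>t h. of_real (covariance M (Z (t + h)) (Z t)) = fourier_coeff f h)"

text \<open>
  Coefficients may vanish, so the order is at most two.
\<close>

definition stationary_AR2 :: "'a measure \<Rightarrow> (int \<Rightarrow> 'a \<Rightarrow> real) \<Rightarrow> bool" where
  "stationary_AR2 M Z \<longleftrightarrow>
     weakly_stationary M Z \<and>
     (\<exists>a1 a2 \<epsilon>. white_noise M \<epsilon> \<and>
        (\<forall>t. AE x in M. Z t x = a1 * Z (t - 1) x + a2 * Z (t - 2) x + \<epsilon> t x))"

text \<open>
  Taking the path space \<^typ>\<open>int \<Rightarrow> real\<close> as sample space is no restriction, since only the law of
  the process matters. A spectral density is determined only almost everywhere; that of an
  autoregression has exactly one continuous version, namely
  \<open>v / (2 \<pi> \<bar>1 - a1 z - a2 z\<^sup>2\<bar>\<^sup>2)\<close> at \<open>z = exp (-\<i> \<omega>)\<close> with \<open>v\<close> the noise variance, and this is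
  the one meant. (A set of densities need then contain no other versions in order to contain
  \<open>F_AR2\<close>.)
\<close>

definition F_AR2 :: "(real \<Rightarrow> real) set" where
  "F_AR2 = {f \<in> F_all. continuous_on {-pi..pi} f \<and>
      (\<exists>(M :: (int \<Rightarrow> real) measure) Z. stationary_AR2 M Z \<and> has_spectral_density M Z f)}"

text \<open>
  The Fourier coefficients of the even functions in \<open>F_all\<close> are real.
\<close>

definition Sigma_mat :: "(real \<Rightarrow> real) \<Rightarrow> real ^ 'n::{finite,linorder} ^ 'n::{finite,linorder}" where
  "Sigma_mat f = (\<chi> j l. Re (fourier_coeff f (int (pos j) - int (pos l))))"

definition M0 :: "real ^ 'k ^ 'n \<Rightarrow> real ^ 'k ^ 'q \<Rightarrow> real ^ 'q \<Rightarrow> (real ^ 'n) set" where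
  "M0 X R r = {X *v \<beta> | \<beta>. R *v \<beta> = r}"

text \<open>
  \<open>X = (F, X')\<close> where \<open>F\<close> consists of the first \<open>kF\<close> columns, and \<open>R\<close> is nonzero in one of the
  columns belonging to \<open>F\<close>; the rank condition on \<open>X\<close> is a standing assumption.
\<close>

definition polynomial_trend ::
    "real ^ 'k::{finite,linorder} ^ 'n::{finite,linorder} \<Rightarrow>
     real ^ 'k::{finite,linorder} ^ 'q \<Rightarrow> nat \<Rightarrow> bool" where
  "polynomial_trend X R kF \<longleftrightarrow>
     1 \<le> kF \<and> kF \<le> CARD('k) \<and>
     (\<forall>t j. pos j \<le> kF \<longrightarrow> X $ t $ j = real (pos t) ^ (pos j - 1)) \<and>
     (\<exists>i. pos i \<le> kF \<and> column i R \<noteq> 0)"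

text \<open>
  The functions are total; their values on \<open>N\<close> play no role.
\<close>

definition estimator_conditions ::
    "real ^ 'k ^ 'n \<Rightarrow> (real ^ 'n \<Rightarrow> real ^ 'k) \<Rightarrow> (real ^ 'n \<Rightarrow> real ^ 'q ^ 'q) \<Rightarrow>
     (real ^ 'n) set \<Rightarrow> bool" where
  "estimator_conditions X \<beta> \<Omega> N \<longleftrightarrow>
     closed N \<and> N \<in> null_sets lebesgue \<and>
     continuous_on (- N) \<beta> \<and> continuous_on (- N) \<Omega> \<and>
     (\<forall>y. y \<notin> N \<longrightarrow> transpose (\<Omega> y) = \<Omega> y) \<and>
     (\<forall>y \<delta> \<eta>. y \<notin> N \<longrightarrow> \<delta> \<noteq> 0 \<longrightarrow> \<delta> *\<^sub>R y + X *v \<eta> \<notin> N) \<and>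
     (\<forall>y \<delta> \<eta>. y \<notin> N \<longrightarrow> \<delta> \<noteq> 0 \<longrightarrow>
        \<beta> (\<delta> *\<^sub>R y + X *v \<eta>) = \<delta> *\<^sub>R \<beta> y + \<eta> \<and>
        \<Omega> (\<delta> *\<^sub>R y + X *v \<eta>) = \<delta>\<^sup>2 *\<^sub>R \<Omega> y) \<and>
     (AE y in lebesgue. y \<notin> N \<longrightarrow> invertible (\<Omega> y))"

definition N_star :: "(real ^ 'n \<Rightarrow> real ^ 'q ^ 'q) \<Rightarrow> (real ^ 'n) set \<Rightarrow> (real ^ 'n) set" where
  "N_star \<Omega> N = N \<union> {y. y \<notin> N \<and> det (\<Omega> y) = 0}"

definition F_type_statistic ::
    "real ^ 'k ^ 'q \<Rightarrow> real ^ 'q \<Rightarrow> (real ^ 'n \<Rightarrow> real ^ 'k) \<Rightarrow> (real ^ 'n \<Rightarrow> real ^ 'q ^ 'q) \<Rightarrow>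
     (real ^ 'n) set \<Rightarrow> real ^ 'n \<Rightarrow> real" where
  "F_type_statistic R r \<beta> \<Omega> N y =
     (if y \<in> N_star \<Omega> N then 0
      else (R *v \<beta> y - r) \<bullet> (matrix_inv (\<Omega> y) *v (R *v \<beta> y - r)))"

end

theory Submission
  imports Defs
begin

text \<open>
  Put a pair of complex conjugate roots of the autoregressive polynomial at \<open>exp (\<plusminus>\<i> w) / \<rho>\<close> and let
  \<open>\<rho> \<rightarrow> 1\<close>: the spectral mass concentrates at \<open>\<plusminus>w\<close>, so the disturbance approaches
  \<open>c cos (w t) + s sin (w t)\<close> with random \<open>c\<close> and \<open>s\<close>. Now let \<open>w \<rightarrow> 0\<close>. By Taylor expansion this path is
  a polynomial of degree less than \<open>kF\<close>, which lies in the column space of \<open>X\<close>, plus a remainder of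
  order \<open>w ^ kF\<close>. By equivariance the covariance estimator only sees the remainder and is of order
  \<open>w ^ (2 * kF)\<close>, whereas \<open>R \<beta> - r\<close> is of exact order \<open>w ^ p\<close> for the smallest degree \<open>p < kF\<close> whose
  column of \<open>R\<close> is nonzero. Hence the statistic tends to infinity almost surely.
\<close>

section \<open>Absolute continuity of Gaussian laws\<close>

text \<open>The two limits are coupled: for each \<open>w\<close>, the radius \<open>\<rho>\<close>
  is taken so close to 1 that the rows of the covariance root are within \<open>w ^ kF\<close> of a
  harmonic path. This is the order of the Taylor remainder, so the approximation costs no order.

  The obstacle is that \<open>gaussian_measure\<close> uses a root \<open>B\<close> fixed only by
  choice, and convergent covariances need not have convergent roots. But the norm of
  \<open>transpose B *v x\<close> depends on the covariance alone, which forces the rows of any root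
  near \<open>cos (w t) d1 + sin (w t) d2\<close>. The vectors \<open>d1\<close>, \<open>d2\<close>
  have norms bounded above and away from zero, so they converge to nonzero limits along a
  subsequence. All laws are images of one normal vector; dominated convergence turns almost sure
  divergence into probabilities tending to 1.

  Both limiting amplitudes have to be nonzero, because a Taylor coefficient of even degree comes
  from the cosine and one of odd degree from the sine.

  Membership in \<open>F_AR2\<close> asks for an actual process driven by white noise. Only second
  moments matter there, so a harmonic with random frequency and random sign serves.\<close>

lemma PiM_density:
  assumes "finite I" and M: "product_sigma_finite M"
    and D: "product_sigma_finite (\<lambda>i. density (M i) (f i))"
    and f [measurable]: "\<And>i. i \<in> I \<Longrightarrow> f i \<in> borel_measurable (M i)"
  shows "(\<Pi>\<^sub>M i\<in>I. density (M i) (f i)) = density (\<Pi>\<^sub>M i\<in>I. M i) (\<lambda>x. \<Prod>i\<in>I. f i (x i))"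
proof -
  interpret product_sigma_finite M by fact
  interpret D: product_sigma_finite "\<lambda>i. density (M i) (f i)" by fact
  have "density (\<Pi>\<^sub>M i\<in>I. M i) (\<lambda>x. \<Prod>i\<in>I. f i (x i)) = (\<Pi>\<^sub>M i\<in>I. density (M i) (f i))"
  proof (rule D.PiM_eqI)
    show "finite I" by fact
    show "sets (density (\<Pi>\<^sub>M i\<in>I. M i) (\<lambda>x. \<Prod>i\<in>I. f i (x i))) = sets (\<Pi>\<^sub>M i\<in>I. density (M i) (f i))"
      by (simp cong: sets_PiM_cong)
    fix A assume "\<And>i. i \<in> I \<Longrightarrow> A i \<in> sets (density (M i) (f i))"
    then have A [measurable]: "\<And>i. i \<in> I \<Longrightarrow> A i \<in> sets (M i)" by simp
    have "emeasure (density (\<Pi>\<^sub>M i\<in>I. M i) (\<lambda>x. \<Prod>i\<in>I. f i (x i))) (Pi\<^sub>E I A)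
        = (\<integral>\<^sup>+x. (\<Prod>i\<in>I. f i (x i)) * indicator (Pi\<^sub>E I A) x \<partial>(\<Pi>\<^sub>M i\<in>I. M i))"
      using \<open>finite I\<close> A by (subst emeasure_density) (auto intro!: sets_PiM_I_finite borel_measurable_prod_ennreal)
    also have "\<dots> = (\<integral>\<^sup>+x. (\<Prod>i\<in>I. f i (x i) * indicator (A i) (x i)) \<partial>(\<Pi>\<^sub>M i\<in>I. M i))"
    proof (rule nn_integral_cong)
      fix x assume "x \<in> space (Pi\<^sub>M I M)"
      then have "(indicator (Pi\<^sub>E I A) x :: ennreal) = (\<Prod>i\<in>I. indicator (A i) (x i))"
        using \<open>finite I\<close> by (auto simp: indicator_def space_PiM PiE_iff prod_zero_iff)
      then show "(\<Prod>i\<in>I. f i (x i)) * indicator (Pi\<^sub>E I A) x = (\<Prod>i\<in>I. f i (x i) * indicator (A i) (x i))"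
        by (simp add: prod.distrib)
    qed
    also have "\<dots> = (\<Prod>i\<in>I. \<integral>\<^sup>+x. f i x * indicator (A i) x \<partial>M i)"
      using \<open>finite I\<close> by (intro product_nn_integral_prod) auto
    also have "\<dots> = (\<Prod>i\<in>I. emeasure (density (M i) (f i)) (A i))"
      by (intro prod.cong refl) (simp add: emeasure_density)
    finally show "emeasure (density (\<Pi>\<^sub>M i\<in>I. M i) (\<lambda>x. \<Prod>i\<in>I. f i (x i))) (Pi\<^sub>E I A)
        = (\<Prod>i\<in>I. emeasure (density (M i) (f i)) (A i))" .
  qed
  then show ?thesis by simp
qed

lemma measurable_vec_lambda [measurable]:
  "(\<lambda>z. \<chi> i. z i) \<in> (\<Pi>\<^sub>M i\<in>UNIV. (borel :: real measure)) \<rightarrow>\<^sub>M (borel :: (real ^ 'n::finite) measure)"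
proof (rule borel_measurable_euclidean_space[THEN iffD2], safe)
  fix b :: "real ^ 'n" assume "b \<in> Basis"
  then obtain i where "b = axis i 1" by (auto simp: Basis_vec_def)
  then show "(\<lambda>z. (\<chi> i. z i) \<bullet> b) \<in> borel_measurable (\<Pi>\<^sub>M i\<in>UNIV. (borel :: real measure))"
    by (simp add: inner_axis)
qed

text \<open>Lebesgue measure is determined by its values on boxes, and a box pulls back to a product
  of intervals.\<close>

lemma distr_PiM_lborel_vec:
  "distr (\<Pi>\<^sub>M i\<in>(UNIV :: 'n::finite set). (lborel :: real measure)) borel (\<lambda>z. \<chi> i. z i) = lborel"
proof (rule lborel_eqI[symmetric])
  interpret product_sigma_finite "\<lambda>i::'n. (lborel :: real measure)" by standard
  fix l u :: "real ^ 'n"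
  assume le: "\<And>b. b \<in> Basis \<Longrightarrow> l \<bullet> b \<le> u \<bullet> b"
  have le': "l $ i \<le> u $ i" for i using le[of "axis i 1"] by (simp add: inner_axis)
  have *: "(\<lambda>z. \<chi> i. z i) -` box l u \<inter> space (\<Pi>\<^sub>M i\<in>(UNIV :: 'n set). (lborel :: real measure))
      = Pi\<^sub>E UNIV (\<lambda>i. box (l $ i) (u $ i))"
    by (auto simp: mem_box_cart space_PiM PiE_iff)
  have "emeasure (distr (\<Pi>\<^sub>M i\<in>(UNIV :: 'n set). (lborel :: real measure)) borel (\<lambda>z. \<chi> i. z i)) (box l u)
     = (\<Prod>i\<in>UNIV. ennreal (u $ i - l $ i))"
    by (subst emeasure_distr) (simp_all add: * emeasure_PiM le')
  also have "\<dots> = ennreal (\<Prod>i\<in>UNIV. u $ i - l $ i)" by (simp add: prod_ennreal le')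
  also have "(\<Prod>i\<in>UNIV. u $ i - l $ i) = (\<Prod>b\<in>Basis. (u - l) \<bullet> b)"
    by (simp add: Basis_vec_def UNION_singleton_eq_range prod.reindex inj_on_def axis_eq_axis inner_axis)
  finally show "emeasure (distr (\<Pi>\<^sub>M i\<in>(UNIV :: 'n set). (lborel :: real measure)) borel (\<lambda>z. \<chi> i. z i)) (box l u)
     = (\<Prod>b\<in>Basis. (u - l) \<bullet> b)" by (simp add: prod_ennreal)
qed simp

text \<open>The source of randomness inside \<open>gaussian_measure\<close>. Keeping it apart from
  its affine images lets all covariance matrices be compared on one probability space.\<close>

definition std_gauss :: "('n::finite \<Rightarrow> real) measure" where
  "std_gauss = (\<Pi>\<^sub>M i\<in>UNIV. density lborel std_normal_density)"

lemma sets_std_gauss [measurable_cong]: "sets std_gauss = sets (\<Pi>\<^sub>M i\<in>UNIV. (borel :: real measure))"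
  unfolding std_gauss_def by (intro sets_PiM_cong) auto

lemma prob_space_std_gauss: "prob_space (std_gauss :: ('n::finite \<Rightarrow> real) measure)"
  unfolding std_gauss_def by (intro prob_space_PiM prob_space_normal_density) simp

lemma AE_std_gauss_not_in_negligible:
  assumes "negligible (S :: (real ^ 'n::finite) set)"
  shows "AE z in std_gauss. (\<chi> i. z i) \<notin> S"
proof -
  have "S \<in> null_sets lebesgue" using assms by (simp add: negligible_iff_null_sets)
  \<comment> \<open>A negligible set need not be Borel; it is enclosed in a Borel null set, to which
    the rules for images and densities apply.\<close>
  then obtain S' where S': "S \<subseteq> S'" "S' \<in> null_sets lborel"
    by (auto simp: null_sets_completion_iff2)
  have 1: "AE z in \<Pi>\<^sub>M i\<in>UNIV. lborel. (\<chi> i. z i) \<notin> S'"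
  proof -
    have "AE y in distr (\<Pi>\<^sub>M i\<in>(UNIV :: 'n set). (lborel :: real measure)) borel (\<lambda>z. \<chi> i. z i). y \<notin> S'"
      using S'(2) unfolding distr_PiM_lborel_vec by (rule AE_not_in)
    moreover have "S' \<in> sets borel" using S'(2) by (auto simp: null_sets_def)
    ultimately show ?thesis by (subst (asm) AE_distr_iff) auto
  qed
  have eq: "std_gauss = density (\<Pi>\<^sub>M i\<in>(UNIV :: 'n set). lborel) (\<lambda>x. \<Prod>i\<in>UNIV. ennreal (std_normal_density (x i)))"
    unfolding std_gauss_def
    by (intro PiM_density) (auto simp: product_sigma_finite_def prob_space_normal_density
        intro!: prob_space_imp_sigma_finite sigma_finite_lborel)
  have "AE z in std_gauss. (\<chi> i. z i) \<notin> S'"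
    unfolding eq by (subst AE_density) (use 1 in \<open>auto intro!: borel_measurable_prod_ennreal\<close>)
  then show ?thesis by (rule eventually_mono) (use S'(1) in auto)
qed

section \<open>Gram vectors of a positive definite matrix\<close>

text \<open>Gram vectors are built one index at a time, as in the Cholesky factorization: the new
  vector is the combination of the old ones with the prescribed inner products, plus a multiple of a
  fresh orthogonal direction. Existence of a root is what gives the choice in
  \<open>gaussian_measure\<close> its defining property.\<close>

lemma matrix_factor_exists:
  fixes A :: "real ^ 'n ^ 'n"
  assumes sym: "\<And>i j. A $ i $ j = A $ j $ i"
    and pos: "\<And>x. x \<noteq> 0 \<Longrightarrow> 0 < (\<Sum>i\<in>UNIV. \<Sum>j\<in>UNIV. x $ i * x $ j * A $ i $ j)"
  shows "\<exists>B :: real ^ 'n ^ 'n. B ** transpose B = A"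
proof -
  have "\<exists>v :: 'n \<Rightarrow> real ^ 'n. \<forall>i\<in>I. \<forall>j\<in>I. v i \<bullet> v j = A $ i $ j" if "finite I" for I
    using that
  proof (induction I)
    case empty
    show ?case by simp
  next
    case (insert i I)
    then obtain v :: "'n \<Rightarrow> real ^ 'n" where v: "\<And>j k. j \<in> I \<Longrightarrow> k \<in> I \<Longrightarrow> v j \<bullet> v k = A $ j $ k"
      by blast
    have "dim (v ` I) \<le> card (v ` I)" by (intro dim_le_card') (simp add: insert)
    also have "\<dots> \<le> card I" by (rule card_image_le) (fact insert)
    also have "\<dots> < card (UNIV :: 'n set)" using insert(2) by (intro psubset_card_mono) auto
    finally have "dim (v ` I) < DIM(real ^ 'n)" by simp
    then obtain u where u: "u \<noteq> 0" "\<And>y. y \<in> span (v ` I) \<Longrightarrow> orthogonal u y"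
      using orthogonal_to_subspace_exists by blast
    define u' where "u' = u /\<^sub>R norm u"
    have u'u': "u' \<bullet> u' = 1" using u(1) by (simp add: u'_def dot_square_norm power2_eq_square)
    have u'v: "u' \<bullet> v j = 0" if "j \<in> I" for j
      using u(2)[of "v j"] that by (simp add: u'_def span_base orthogonal_def)
    \<comment> \<open>The equations for the coefficients only involve indices in \<open>I\<close>.
      Acting as the identity on the other coordinates makes \<open>L\<close> an endomorphism, for
      which injectivity gives solvability.\<close>
    define L where "L c = (\<chi> k. if k \<in> I then \<Sum>j\<in>I. A $ k $ j * c $ j else c $ k)" for c :: "real ^ 'n"
    have linL: "linear L"
      by (rule linearI) (auto simp: L_def vec_eq_iff algebra_simps sum.distrib sum_distrib_left)
    have quad: "(\<Sum>i\<in>UNIV. \<Sum>j\<in>UNIV. c $ i * c $ j * A $ i $ j) = (\<Sum>i\<in>I. c $ i * (\<Sum>j\<in>I. A $ i $ j * c $ j))"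
      if "\<And>j. j \<notin> I \<Longrightarrow> c $ j = 0" for c :: "real ^ 'n"
    proof -
      have "(\<Sum>i\<in>UNIV. \<Sum>j\<in>UNIV. c $ i * c $ j * A $ i $ j) = (\<Sum>i\<in>I. \<Sum>j\<in>UNIV. c $ i * c $ j * A $ i $ j)"
        using that by (intro sum.mono_neutral_right) auto
      also have "\<dots> = (\<Sum>i\<in>I. \<Sum>j\<in>I. c $ i * c $ j * A $ i $ j)"
        using that by (intro sum.cong sum.mono_neutral_right refl) auto
      finally show ?thesis by (simp add: sum_distrib_left mult_ac)
    qed
    have "inj L"
    proof (subst linear_injective_0[OF linL], intro allI impI)
      fix c assume Lc: "L c = 0"
      then have *: "(if k \<in> I then \<Sum>j\<in>I. A $ k $ j * c $ j else c $ k) = 0" for k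
        by (simp add: L_def vec_eq_iff)
      have "c $ k = 0" if "k \<notin> I" for k using *[of k] that by simp
      moreover have "(\<Sum>j\<in>I. A $ k $ j * c $ j) = 0" if "k \<in> I" for k using *[of k] that by simp
      ultimately have "(\<Sum>i\<in>UNIV. \<Sum>j\<in>UNIV. c $ i * c $ j * A $ i $ j) = 0"
        by (subst quad) auto
      then show "c = 0" using pos[of c] by (cases "c = 0") auto
    qed
    then have "surj L" by (simp add: linear_injective_imp_surjective[OF linL])
    then obtain c where c: "L c = (\<chi> k. if k \<in> I then A $ i $ k else 0)" by (metis surjD)
    have c0: "c $ k = 0" if "k \<notin> I" for k
      using c that by (simp add: L_def vec_eq_iff) (metis (full_types))
    have c1: "(\<Sum>j\<in>I. A $ k $ j * c $ j) = A $ i $ k" if "k \<in> I" for k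
      using c that by (simp add: L_def vec_eq_iff) (metis (full_types))
    define q where "q = (\<Sum>k\<in>I. c $ k * A $ i $ k)"
    define w where "w = (\<Sum>j\<in>I. c $ j *\<^sub>R v j)"
    have wv: "w \<bullet> v k = A $ i $ k" if "k \<in> I" for k
      using c1[OF that] that v sym by (simp add: w_def inner_sum_left mult.commute)
    have ww: "w \<bullet> w = q"
      unfolding q_def by (subst (2) w_def) (simp add: inner_sum_right wv)
    have u'w: "u' \<bullet> w = 0" by (simp add: w_def inner_sum_right u'v)
    \<comment> \<open>The Schur complement, obtained as the value of the quadratic form at
      \<open>axis i 1 - c\<close>.\<close>
    have "0 \<le> A $ i $ i - q"
    proof -
      define x where "x = axis i 1 - c"
      have x: "x $ k = (if k = i then 1 else 0) - c $ k" for k by (simp add: x_def axis_def)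
      have ci: "c $ i = 0" using c0 insert by simp
      have "x \<noteq> 0" using x[of i] ci by auto
      have "(\<Sum>j\<in>UNIV. x $ k * x $ j * A $ k $ j) = x $ k * (A $ k $ i - (\<Sum>j\<in>I. A $ k $ j * c $ j))" for k
      proof -
        have "(\<Sum>j\<in>UNIV. x $ k * x $ j * A $ k $ j) = x $ k * ((\<Sum>j\<in>UNIV. (if j = i then A $ k $ j else 0)) - (\<Sum>j\<in>UNIV. A $ k $ j * c $ j))"
          unfolding sum_subtractf[symmetric] sum_distrib_left
          by (intro sum.cong refl) (auto simp: x algebra_simps)
        also have "(\<Sum>j\<in>UNIV. A $ k $ j * c $ j) = (\<Sum>j\<in>I. A $ k $ j * c $ j)"
          using c0 by (intro sum.mono_neutral_right) auto
        finally show ?thesis by simp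
      qed
      then have "(\<Sum>k\<in>UNIV. \<Sum>j\<in>UNIV. x $ k * x $ j * A $ k $ j)
          = (\<Sum>k\<in>UNIV. x $ k * (A $ k $ i - (\<Sum>j\<in>I. A $ k $ j * c $ j)))" by simp
      also have "\<dots> = (\<Sum>k\<in>{i}. x $ k * (A $ k $ i - (\<Sum>j\<in>I. A $ k $ j * c $ j)))"
      proof (intro sum.mono_neutral_right ballI)
        fix k assume "k \<in> UNIV - {i}"
        then show "x $ k * (A $ k $ i - (\<Sum>j\<in>I. A $ k $ j * c $ j)) = 0"
          using c0[of k] c1[of k] sym[of k i] by (cases "k \<in> I") (auto simp: x)
      qed auto
      also have "\<dots> = A $ i $ i - q"
        using ci by (simp add: x q_def mult.commute)
      finally show ?thesis using pos[OF \<open>x \<noteq> 0\<close>] by simp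
    qed
    define v' where "v' = v(i := w + sqrt (A $ i $ i - q) *\<^sub>R u')"
    have v'i: "v' i = w + sqrt (A $ i $ i - q) *\<^sub>R u'" and v'j: "\<And>j. j \<in> I \<Longrightarrow> v' j = v j"
      using insert(2) by (auto simp: v'_def)
    have 1: "v' i \<bullet> v' i = A $ i $ i"
    proof -
      have "v' i \<bullet> v' i = w \<bullet> w + 2 * sqrt (A $ i $ i - q) * (u' \<bullet> w) + (sqrt (A $ i $ i - q))\<^sup>2 * (u' \<bullet> u')"
        unfolding v'i by (simp add: inner_simps inner_commute[of w u'] power2_eq_square algebra_simps)
      then show ?thesis using \<open>0 \<le> A $ i $ i - q\<close> by (simp add: u'u' u'w ww)
    qed
    have 2: "v' i \<bullet> v' j = A $ i $ j" if "j \<in> I" for j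
      using that by (simp add: v'i v'j inner_simps wv u'v)
    have "v' j \<bullet> v' k = A $ j $ k" if jk: "j \<in> insert i I" "k \<in> insert i I" for j k
    proof -
      consider "j = i" "k = i" | "j = i" "k \<in> I" | "j \<in> I" "k = i" | "j \<in> I" "k \<in> I"
        using jk by blast
      then show ?thesis
      proof cases
        case 3
        then show ?thesis using 2[of j] sym[of i j] by (simp add: inner_commute)
      qed (use 1 2 v v'j in auto)
    qed
    then show ?case by blast
  qed
  from this[of UNIV] obtain v :: "'n \<Rightarrow> real ^ 'n" where "\<And>i j. v i \<bullet> v j = A $ i $ j" by auto
  then have "(\<chi> i. v i) ** transpose (\<chi> i. v i) = A"
    by (simp add: matrix_matrix_mult_def transpose_def vec_eq_iff inner_vec_def)
  then show ?thesis by blast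
qed

section \<open>Autoregressive spectral densities\<close>

lemma continuous_imp_set_integrable:
  fixes g :: "real \<Rightarrow> 'b::euclidean_space"
  assumes "continuous_on UNIV g"
  shows "set_integrable lborel {-pi..pi} g"
  by (rule borel_integrable_atLeastAtMost') (rule continuous_on_subset[OF assms], simp)

text \<open>The interval is symmetric, so only the even part of an integrand counts. This is what
  removes the sine terms from the autocovariances.\<close>

lemma set_integral_even_part:
  fixes g :: "real \<Rightarrow> real"
  assumes g: "continuous_on UNIV g" and h: "\<And>x. g x + g (- x) = 2 * h x"
  shows "(LINT x:{-pi..pi}|lborel. g x) = (LINT x:{-pi..pi}|lborel. h x)"
proof -
  have g': "continuous_on UNIV (\<lambda>x. g (- x))"
    by (rule continuous_on_compose2[OF g]) (auto intro: continuous_intros)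
  have "(LINT x:{-pi..pi}|lborel. g x) = (LINT x:{x. - x \<in> {-pi..pi}}|lborel. g (- x))"
    by (rule set_integral_reflect)
  also have "{x. - x \<in> {-pi..pi}} = {-pi..pi}" by auto
  finally have "2 * (LINT x:{-pi..pi}|lborel. g x)
      = (LINT x:{-pi..pi}|lborel. g x) + (LINT x:{-pi..pi}|lborel. g (- x))" by simp
  also have "\<dots> = (LINT x:{-pi..pi}|lborel. g x + g (- x))"
    by (intro set_integral_add(2)[symmetric] continuous_imp_set_integrable g g')
  also have "\<dots> = 2 * (LINT x:{-pi..pi}|lborel. h x)" by (simp add: h)
  finally show ?thesis by simp
qed

lemma fourier_coeff_even:
  assumes f: "continuous_on UNIV f" and even: "\<And>x. f (- x) = f x"
  shows "fourier_coeff (restrict f {-pi..pi}) h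
      = of_real (LINT x:{-pi..pi}|lborel. f x * cos (of_int h * x))"
proof -
  let ?e = "\<lambda>x. of_real (f x * cos (of_int h * x)) + (- \<i>) * of_real (f x * sin (of_int h * x)) :: complex"
  have [measurable]: "f \<in> borel_measurable borel" using f by (rule borel_measurable_continuous_onI)
  have c: "continuous_on UNIV (\<lambda>x. f x * cos (of_int h * x))" "continuous_on UNIV (\<lambda>x. f x * sin (of_int h * x))"
    using f by (auto intro!: continuous_intros)
  have "fourier_coeff (restrict f {-pi..pi}) h = (LINT x:{-pi..pi}|lebesgue. ?e x)"
    unfolding fourier_coeff_def
  proof (intro set_lebesgue_integral_cong allI impI)
    fix x :: real assume "x \<in> {-pi..pi}"
    have "exp (- \<i> * of_int h * of_real x) = cis (- (of_int h * x))"
      by (simp add: cis_conv_exp mult_ac)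
    also have "\<dots> = of_real (cos (of_int h * x)) - \<i> * of_real (sin (of_int h * x))"
      by (simp add: complex_eq_iff)
    finally show "exp (- \<i> * of_int h * of_real x) * of_real (restrict f {-pi..pi} x) = ?e x"
      using \<open>x \<in> {-pi..pi}\<close> by (simp only: restrict_apply' of_real_mult) (simp add: algebra_simps)
  qed simp
  also have "\<dots> = (LINT x:{-pi..pi}|lborel. ?e x)"
    unfolding set_lebesgue_integral_def by (rule integral_completion) measurable
  also have "\<dots> = (LINT x:{-pi..pi}|lborel. of_real (f x * cos (of_int h * x)))
      + (LINT x:{-pi..pi}|lborel. (- \<i>) * of_real (f x * sin (of_int h * x)) :: complex)"
    by (intro set_integral_add(2) continuous_imp_set_integrable continuous_intros f)
  also have "(LINT x:{-pi..pi}|lborel. (- \<i>) * of_real (f x * sin (of_int h * x)) :: complex) = 0"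
  proof -
    have "(LINT x:{-pi..pi}|lborel. f x * sin (of_int h * x)) = (LINT x:{-pi..pi}|lborel. 0)"
      by (rule set_integral_even_part[OF c(2)]) (simp add: even)
    then have "(LINT x:{-pi..pi}|lborel. f x * sin (of_int h * x)) = 0" by simp
    then show ?thesis by (simp only: set_integral_mult_right set_integral_complex_of_real) simp
  qed
  finally show ?thesis by (simp only: set_integral_complex_of_real) simp
qed

lemma set_integral_cos_int:
  "(LINT x:{-pi..pi}|lborel. cos (of_int h * x)) = (if h = 0 then 2 * pi else 0)"
proof (cases "h = 0")
  case True
  then show ?thesis by (simp add: set_lebesgue_integral_def)
next
  case False
  have "(LBINT x. cos (of_int h * x) * indicator {-pi..pi} x)
      = sin (of_int h * pi) / of_int h - sin (of_int h * (- pi)) / of_int h"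
    using False
    by (intro integral_FTC_Icc_real[where F="\<lambda>x. sin (of_int h * x) / of_int h"])
      (auto intro!: derivative_eq_intros continuous_intros)
  then show ?thesis using False by (simp add: set_lebesgue_integral_def mult.commute)
qed

text \<open>
  The law of a frequency with density \<open>f\<close> and an independent random sign. The sign centres the
  process \<open>s (cos (t \<lambda>) + sin (t \<lambda>))\<close>, whose autocovariances are the Fourier coefficients of \<open>f\<close>.
\<close>

definition freq_sign_space :: "(real \<Rightarrow> real) \<Rightarrow> (real \<times> bool) measure" where
  "freq_sign_space f = density lborel (\<lambda>x. ennreal (indicator {-pi..pi} x * f x))
     \<Otimes>\<^sub>M measure_pmf (bernoulli_pmf (1/2))"

text \<open>\<open>F_AR2\<close> asks for a process on \<open>int \<Rightarrow> real\<close>, so the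
  pair is stored in a sequence, from which \<open>sign_process\<close> reads the frequency at 0 and
  the sign at 1.\<close>

definition freq_sign_path :: "real \<times> bool \<Rightarrow> int \<Rightarrow> real" where
  "freq_sign_path p i = (if i = 0 then fst p else if snd p then 1 else - 1)"

definition freq_sign_law :: "(real \<Rightarrow> real) \<Rightarrow> (int \<Rightarrow> real) measure" where
  "freq_sign_law f = distr (freq_sign_space f) (\<Pi>\<^sub>M i\<in>UNIV. borel) freq_sign_path"

definition sign_process :: "(int \<Rightarrow> real \<Rightarrow> real) \<Rightarrow> int \<Rightarrow> (int \<Rightarrow> real) \<Rightarrow> real" where
  "sign_process w t x = x 1 * w t (x 0)"

context
  fixes f :: "real \<Rightarrow> real"
  assumes f_cont: "continuous_on UNIV f" and f_nonneg: "\<And>x. 0 \<le> f x"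
    and f_int: "(LINT x:{-pi..pi}|lborel. f x) = 1"
begin

lemma freq_density_measurable [measurable]: "f \<in> borel_measurable borel"
  using f_cont by (rule borel_measurable_continuous_onI)

lemma prob_space_freq_density: "prob_space (density lborel (\<lambda>x. ennreal (indicator {-pi..pi} x * f x)))"
proof (rule prob_spaceI)
  have "emeasure (density lborel (\<lambda>x. ennreal (indicator {-pi..pi} x * f x))) (space (density lborel (\<lambda>x. ennreal (indicator {-pi..pi} x * f x))))
    = (\<integral>\<^sup>+x. ennreal (indicator {-pi..pi} x * f x) \<partial>lborel)"
    by (simp add: emeasure_density)
  also have "\<dots> = ennreal (LINT x:{-pi..pi}|lborel. f x)"
    using continuous_imp_set_integrable[OF f_cont] f_nonneg
    by (subst nn_integral_eq_integral) (auto simp: set_integrable_def set_lebesgue_integral_def)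
  finally show "emeasure (density lborel (\<lambda>x. ennreal (indicator {-pi..pi} x * f x))) (space (density lborel (\<lambda>x. ennreal (indicator {-pi..pi} x * f x)))) = 1"
    by (simp add: f_int)
qed

lemma prob_space_freq_sign_space: "prob_space (freq_sign_space f)"
proof -
  interpret D: prob_space "density lborel (\<lambda>x. ennreal (indicator {-pi..pi} x * f x))"
    by (rule prob_space_freq_density)
  interpret P: pair_prob_space "density lborel (\<lambda>x. ennreal (indicator {-pi..pi} x * f x))" "measure_pmf (bernoulli_pmf (1/2))" ..
  show ?thesis unfolding freq_sign_space_def by (rule P.prob_space_axioms)
qed

text \<open>Fubini with a two-point second factor: the sign contributes the average of its two
  values. Boundedness gives integrability under a probability measure.\<close>

lemma freq_sign_integral:
  assumes g: "\<And>b. continuous_on UNIV (\<lambda>x. g (x, b))" and B: "\<And>p. \<bar>g p\<bar> \<le> B"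
  shows "integrable (freq_sign_space f) g"
    and "(LINT p|freq_sign_space f. g p)
        = (LINT x:{-pi..pi}|lborel. f x * (g (x, True) / 2 + g (x, False) / 2))"
proof -
  let ?D = "density lborel (\<lambda>x. ennreal (indicator {-pi..pi} x * f x))"
  interpret D: prob_space ?D by (rule prob_space_freq_density)
  interpret P: pair_prob_space ?D "measure_pmf (bernoulli_pmf (1/2))" ..
  have [measurable]: "(\<lambda>x. g (x, b)) \<in> borel_measurable borel" for b
    using g by (rule borel_measurable_continuous_onI)
  have "g = (\<lambda>p. if snd p then g (fst p, True) else g (fst p, False))" by (auto simp: fun_eq_iff)
  also have "\<dots> \<in> borel_measurable (freq_sign_space f)"
    unfolding freq_sign_space_def by measurable
  finally have [measurable]: "g \<in> borel_measurable (freq_sign_space f)" .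
  show int: "integrable (freq_sign_space f) g"
    unfolding freq_sign_space_def
    by (rule P.integrable_const_bound[where B=B]) (use B in \<open>auto simp: freq_sign_space_def[symmetric]\<close>)
  have "(LINT p|freq_sign_space f. g p) = (LINT x|?D. (LINT b|measure_pmf (bernoulli_pmf (1/2)). g (x, b)))"
    using int unfolding freq_sign_space_def by (rule P.integral_fst'[symmetric])
  also have "\<dots> = (LINT x|?D. g (x, True) / 2 + g (x, False) / 2)"
    by (simp add: integral_bernoulli_pmf)
  also have "\<dots> = (LINT x|lborel. (indicator {-pi..pi} x * f x) *\<^sub>R (g (x, True) / 2 + g (x, False) / 2))"
    by (rule integral_density) (use f_nonneg in auto)
  finally show "(LINT p|freq_sign_space f. g p)
        = (LINT x:{-pi..pi}|lborel. f x * (g (x, True) / 2 + g (x, False) / 2))"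
    by (simp add: set_lebesgue_integral_def mult_ac)
qed

lemma measurable_freq_sign_path [measurable]:
  "freq_sign_path \<in> freq_sign_space f \<rightarrow>\<^sub>M (\<Pi>\<^sub>M i\<in>UNIV. borel)"
proof (rule measurable_PiM_single')
  fix i :: int
  show "(\<lambda>p. freq_sign_path p i) \<in> borel_measurable (freq_sign_space f)"
    unfolding freq_sign_path_def freq_sign_space_def by measurable
qed (auto simp: space_PiM)

lemma prob_space_freq_sign_law: "prob_space (freq_sign_law f)"
  unfolding freq_sign_law_def
  by (rule prob_space.prob_space_distr[OF prob_space_freq_sign_space]) measurable

lemma sets_freq_sign_law [measurable_cong]: "sets (freq_sign_law f) = sets (\<Pi>\<^sub>M i\<in>UNIV. borel)"
  by (simp add: freq_sign_law_def)

context
  fixes w :: "int \<Rightarrow> real \<Rightarrow> real" and B :: real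
  assumes w_cont: "\<And>t. continuous_on UNIV (w t)" and w_bound: "\<And>t x. \<bar>w t x\<bar> \<le> B"
begin

lemma sign_process_measurable [measurable]: "sign_process w t \<in> borel_measurable (freq_sign_law f)"
proof -
  have [measurable]: "w t \<in> borel_measurable borel" using w_cont by (rule borel_measurable_continuous_onI)
  show ?thesis unfolding sign_process_def by measurable
qed

lemma sign_process_mean: "(LINT x|freq_sign_law f. sign_process w t x) = 0"
proof -
  have "(LINT x|freq_sign_law f. sign_process w t x) = (LINT p|freq_sign_space f. sign_process w t (freq_sign_path p))"
    unfolding freq_sign_law_def
    by (rule integral_distr) (use sign_process_measurable in \<open>auto simp: freq_sign_law_def\<close>)
  also have "\<dots> = (LINT x:{-pi..pi}|lborel. f x * 0)"
    by (subst freq_sign_integral(2)[where B=B])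
      (use w_bound w_cont in \<open>auto simp: sign_process_def freq_sign_path_def intro!: continuous_intros\<close>)
  finally show ?thesis by simp
qed

text \<open>The sign squares to 1, so it disappears from second moments and only the average over
  the frequency remains.\<close>

lemma sign_process_product:
  shows "integrable (freq_sign_law f) (\<lambda>x. sign_process w s x * sign_process w t x)"
    and "(LINT x|freq_sign_law f. sign_process w s x * sign_process w t x)
       = (LINT x:{-pi..pi}|lborel. f x * (w s x * w t x))"
proof -
  have [measurable]: "(\<lambda>x. sign_process w s x * sign_process w t x) \<in> borel_measurable (freq_sign_law f)"
    by measurable
  have bd: "\<bar>w s x * w t x\<bar> \<le> B * B" for x
    unfolding abs_mult using w_bound[of _ x] by (intro mult_mono) (auto intro: order_trans[OF abs_ge_zero])
  show "integrable (freq_sign_law f) (\<lambda>x. sign_process w s x * sign_process w t x)"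
    unfolding freq_sign_law_def
  proof (subst integrable_distr_eq)
    show "integrable (freq_sign_space f) (\<lambda>p. sign_process w s (freq_sign_path p) * sign_process w t (freq_sign_path p))"
      by (rule freq_sign_integral(1)[where B="B*B"])
        (use bd w_cont in \<open>auto simp: sign_process_def freq_sign_path_def intro!: continuous_intros\<close>)
  qed (use sign_process_measurable in \<open>auto simp: freq_sign_law_def\<close>)
  have "(LINT x|freq_sign_law f. sign_process w s x * sign_process w t x)
      = (LINT p|freq_sign_space f. sign_process w s (freq_sign_path p) * sign_process w t (freq_sign_path p))"
    unfolding freq_sign_law_def
    by (rule integral_distr) (use sign_process_measurable in \<open>auto simp: freq_sign_law_def\<close>)
  also have "\<dots> = (LINT x:{-pi..pi}|lborel. f x * (w s x * w t x))"
    by (subst freq_sign_integral(2)[where B="B*B"])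
      (use bd w_cont in \<open>auto simp: sign_process_def freq_sign_path_def intro!: continuous_intros\<close>)
  finally show "(LINT x|freq_sign_law f. sign_process w s x * sign_process w t x)
       = (LINT x:{-pi..pi}|lborel. f x * (w s x * w t x))" .
qed

lemma sign_process_covariance:
  "covariance (freq_sign_law f) (sign_process w s) (sign_process w t)
     = (LINT x:{-pi..pi}|lborel. f x * (w s x * w t x))"
  by (simp add: covariance_def sign_process_mean sign_process_product)

lemma weakly_stationary_sign_process:
  assumes "\<And>s t. (LINT x:{-pi..pi}|lborel. f x * (w s x * w t x)) = \<gamma> (s - t)"
  shows "weakly_stationary (freq_sign_law f) (sign_process w)"
  using prob_space_freq_sign_law sign_process_measurable sign_process_product(1)
  by (simp add: weakly_stationary_def sign_process_mean sign_process_covariance assms power2_eq_square)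

end

end

text \<open>\<open>ar2_poly a1 a2 x = \<bar>1 - a1 z - a2 z\<^sup>2\<bar>\<^sup>2\<close> at \<open>z = exp (-\<i> x)\<close>.\<close>

definition ar2_poly :: "real \<Rightarrow> real \<Rightarrow> real \<Rightarrow> real" where
  "ar2_poly a1 a2 x = (1 - a1 * cos x - a2 * cos (2 * x))\<^sup>2 + (a1 * sin x + a2 * sin (2 * x))\<^sup>2"

definition ar2_mass :: "real \<Rightarrow> real \<Rightarrow> real" where
  "ar2_mass a1 a2 = (LINT x:{-pi..pi}|lborel. 1 / ar2_poly a1 a2 x)"

text \<open>Comparison with \<open>v / (2 * pi * ar2_poly)\<close> gives the noise variance
  \<open>v = 2 * pi / ar2_mass\<close>, which reappears as the variance of the white noise
  constructed below.\<close>

definition ar2_density :: "real \<Rightarrow> real \<Rightarrow> real \<Rightarrow> real" where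
  "ar2_density a1 a2 x = 1 / (ar2_mass a1 a2 * ar2_poly a1 a2 x)"

definition ar2_cov :: "real \<Rightarrow> real \<Rightarrow> int \<Rightarrow> real" where
  "ar2_cov a1 a2 h = (LINT x:{-pi..pi}|lborel. ar2_density a1 a2 x * cos (of_int h * x))"

lemma continuous_ar2_poly: "continuous_on S (ar2_poly a1 a2)"
  unfolding ar2_poly_def by (intro continuous_intros)

lemma ar2_poly_minus: "ar2_poly a1 a2 (- x) = ar2_poly a1 a2 x"
  by (simp add: ar2_poly_def power2_eq_square algebra_simps)

text \<open>Each of the two squares is at most the square of
  \<open>1 + \<bar>a1\<bar> + \<bar>a2\<bar>\<close>. As a bound on the denominator, this keeps the
  density away from zero.\<close>

lemma ar2_poly_le: "ar2_poly a1 a2 x \<le> 2 * (1 + \<bar>a1\<bar> + \<bar>a2\<bar>)\<^sup>2"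
proof -
  have c: "\<bar>a * cos y\<bar> \<le> \<bar>a\<bar>" "\<bar>a * sin y\<bar> \<le> \<bar>a\<bar>" for a y :: real
    by (simp_all add: abs_mult mult_left_le)
  have "(1 - a1 * cos x - a2 * cos (2 * x))\<^sup>2 \<le> (1 + \<bar>a1\<bar> + \<bar>a2\<bar>)\<^sup>2"
    using c(1)[of a1 x] c(1)[of a2 "2*x"] by (intro abs_le_square_iff[THEN iffD1]) linarith
  moreover have "(a1 * sin x + a2 * sin (2 * x))\<^sup>2 \<le> (1 + \<bar>a1\<bar> + \<bar>a2\<bar>)\<^sup>2"
    using c(2)[of a1 x] c(2)[of a2 "2*x"] by (intro abs_le_square_iff[THEN iffD1]) linarith
  ultimately show ?thesis by (simp add: ar2_poly_def)
qed

lemma set_integral_const_pi: "(LINT x:{-pi..pi}|lborel. (c::real)) = 2 * pi * c"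
  by (simp add: set_lebesgue_integral_def)

context
  fixes a1 a2 :: real
  assumes pos: "\<And>x. 0 < ar2_poly a1 a2 x"
begin

lemma continuous_inverse_ar2_poly: "continuous_on UNIV (\<lambda>x. 1 / ar2_poly a1 a2 x)"
  using pos by (intro continuous_intros continuous_ar2_poly) (metis less_irrefl)

lemma ar2_mass_pos: "0 < ar2_mass a1 a2"
proof -
  let ?c = "2 * (1 + \<bar>a1\<bar> + \<bar>a2\<bar>)\<^sup>2"
  have "0 < (1 + \<bar>a1\<bar> + \<bar>a2\<bar>)\<^sup>2" by (intro zero_less_power) auto
  then have "0 < 2 * pi * (1 / ?c)" by simp
  also have "\<dots> = (LINT x:{-pi..pi}|lborel. 1 / ?c)" by (rule set_integral_const_pi[symmetric])
  also have "\<dots> \<le> (LINT x:{-pi..pi}|lborel. 1 / ar2_poly a1 a2 x)"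
  proof (rule set_integral_mono)
    fix x show "1 / ?c \<le> 1 / ar2_poly a1 a2 x"
      using ar2_poly_le pos by (intro divide_left_mono) auto
  qed (auto intro!: continuous_imp_set_integrable continuous_inverse_ar2_poly continuous_intros)
  finally show ?thesis by (simp add: ar2_mass_def)
qed

lemma continuous_ar2_density: "continuous_on UNIV (ar2_density a1 a2)"
proof -
  have "ar2_density a1 a2 = (\<lambda>x. (1 / ar2_mass a1 a2) * (1 / ar2_poly a1 a2 x))"
    by (simp add: ar2_density_def fun_eq_iff)
  then show ?thesis using continuous_on_mult_left[OF continuous_inverse_ar2_poly] by (simp only:)
qed

lemma ar2_density_pos: "0 < ar2_density a1 a2 x"
  using pos ar2_mass_pos by (simp add: ar2_density_def)

lemma ar2_density_minus: "ar2_density a1 a2 (- x) = ar2_density a1 a2 x"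
  by (simp add: ar2_density_def ar2_poly_minus)

lemma ar2_density_integral: "(LINT x:{-pi..pi}|lborel. ar2_density a1 a2 x) = 1"
proof -
  have "(LINT x:{-pi..pi}|lborel. ar2_density a1 a2 x)
      = (LINT x:{-pi..pi}|lborel. (1 / ar2_mass a1 a2) * (1 / ar2_poly a1 a2 x))"
    by (simp add: ar2_density_def)
  also have "\<dots> = (1 / ar2_mass a1 a2) * ar2_mass a1 a2"
    by (simp only: set_integral_mult_right ar2_mass_def)
  finally show ?thesis using ar2_mass_pos by simp
qed

lemma ar2_density_mult_poly: "ar2_density a1 a2 x * ar2_poly a1 a2 x = 1 / ar2_mass a1 a2"
  using pos[of x] by (simp add: ar2_density_def)

lemma fourier_coeff_ar2: "fourier_coeff (restrict (ar2_density a1 a2) {-pi..pi}) h = of_real (ar2_cov a1 a2 h)"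
  unfolding ar2_cov_def by (rule fourier_coeff_even[OF continuous_ar2_density ar2_density_minus])

lemma ar2_density_in_F_all: "restrict (ar2_density a1 a2) {-pi..pi} \<in> F_all"
proof -
  let ?f = "ar2_density a1 a2"
  have [measurable]: "?f \<in> borel_measurable borel"
    using continuous_ar2_density by (rule borel_measurable_continuous_onI)
  have eq: "(\<lambda>x. indicator {-pi..pi} x *\<^sub>R restrict ?f {-pi..pi} x) = (\<lambda>x. indicator {-pi..pi} x *\<^sub>R ?f x)"
    by (auto simp: fun_eq_iff indicator_def)
  have "set_integrable lebesgue {-pi..pi} (restrict ?f {-pi..pi})"
    using continuous_imp_set_integrable[OF continuous_ar2_density]
    unfolding set_integrable_def eq by (subst integrable_completion) auto
  moreover have "(LINT x:{-pi..pi}|lebesgue. restrict ?f {-pi..pi} x) = 1"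
    using ar2_density_integral unfolding set_lebesgue_integral_def eq
    by (subst integral_completion) auto
  moreover have "\<forall>x\<in>{-pi..pi}. 0 \<le> restrict ?f {-pi..pi} x" "\<forall>x\<in>{-pi..pi}. restrict ?f {-pi..pi} (- x) = restrict ?f {-pi..pi} x"
    using ar2_density_pos ar2_density_minus by (auto simp: less_imp_le)
  ultimately show ?thesis
    unfolding F_all_def by blast
qed

text \<open>The innovation is the autoregressive filter applied to the process, so the recursion
  holds by construction. It is white because the filter multiplies the spectrum by
  \<open>ar2_poly\<close>, and density times \<open>ar2_poly\<close> is constant.\<close>

lemma ar2_density_in_F_AR2: "restrict (ar2_density a1 a2) {-pi..pi} \<in> F_AR2"
proof -
  let ?f = "ar2_density a1 a2"
  let ?M = "freq_sign_law ?f"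
  \<comment> \<open>The product of two such terms is \<open>cos ((s - t) x)\<close> plus the odd
    function \<open>sin ((s + t) x)\<close>, so against an even density only the cosine
    survives.\<close>
  define z where "z t x = cos (of_int t * x) + sin (of_int t * x)" for t :: int and x :: real
  define e where "e t x = z t x - a1 * z (t - 1) x - a2 * z (t - 2) x" for t x
  note law = continuous_ar2_density less_imp_le[OF ar2_density_pos] ar2_density_integral
  have z_cont: "continuous_on UNIV (z t)" for t unfolding z_def by (intro continuous_intros)
  have e_cont: "continuous_on UNIV (e t)" for t
    unfolding e_def by (intro continuous_intros z_cont)
  have z_bd: "\<bar>z t x\<bar> \<le> 2" for t x
    using abs_cos_le_one[of "of_int t * x"] abs_sin_le_one[of "of_int t * x"] unfolding z_def by linarith
  have z_bd': "\<bar>a * z t x\<bar> \<le> \<bar>a\<bar> * 2" for a t x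
    unfolding abs_mult by (intro mult_left_mono z_bd) auto
  have e_bd: "\<bar>e t x\<bar> \<le> 2 + \<bar>a1\<bar> * 2 + \<bar>a2\<bar> * 2" for t x
    using z_bd[of t x] z_bd'[of a1 "t-1" x] z_bd'[of a2 "t-2" x] unfolding e_def by linarith
  have z_prod: "(LINT x:{-pi..pi}|lborel. ?f x * (z s x * z t x)) = ar2_cov a1 a2 (s - t)" for s t
    unfolding ar2_cov_def
  proof (rule set_integral_even_part)
    show "continuous_on UNIV (\<lambda>x. ?f x * (z s x * z t x))"
      by (intro continuous_intros continuous_ar2_density z_cont)
    show "?f x * (z s x * z t x) + ?f (- x) * (z s (- x) * z t (- x)) = 2 * (?f x * cos (of_int (s - t) * x))" for x
      by (simp add: ar2_density_minus z_def left_diff_distrib cos_diff algebra_simps)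
  qed
  have e_prod: "(LINT x:{-pi..pi}|lborel. ?f x * (e s x * e t x)) = (if s - t = 0 then 2 * pi / ar2_mass a1 a2 else 0)" for s t
  proof -
    \<comment> \<open>Filtering multiplies the even part of the product by the squared modulus of
      the transfer function.\<close>
    have e_sym: "e s x * e t x + e s (- x) * e t (- x) = 2 * (cos (of_int (s - t) * x) * ar2_poly a1 a2 x)" for x
    proof -
      have a: "of_int (t - 1) * x = of_int t * x - x" "of_int (t - 2) * x = of_int t * x - 2 * x" for t :: int
        by (simp_all add: algebra_simps)
      have b: "of_int (s - t) * x = of_int s * x - of_int t * x" by (simp add: algebra_simps)
      show ?thesis
        unfolding e_def z_def ar2_poly_def mult_minus_right cos_minus sin_minus a b cos_diff sin_diff
        by algebra
    qed
    have "(LINT x:{-pi..pi}|lborel. ?f x * (e s x * e t x))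
      = (LINT x:{-pi..pi}|lborel. 1 / ar2_mass a1 a2 * cos (of_int (s - t) * x))"
    proof (rule set_integral_even_part)
      show "continuous_on UNIV (\<lambda>x. ?f x * (e s x * e t x))"
        by (intro continuous_intros continuous_ar2_density e_cont)
      fix x
      have "?f x * (e s x * e t x) + ?f (- x) * (e s (- x) * e t (- x))
         = ?f x * (e s x * e t x + e s (- x) * e t (- x))"
        by (simp add: ar2_density_minus distrib_left)
      also have "\<dots> = 2 * ((?f x * ar2_poly a1 a2 x) * cos (of_int (s - t) * x))"
        unfolding e_sym by simp
      finally show "?f x * (e s x * e t x) + ?f (- x) * (e s (- x) * e t (- x))
         = 2 * (1 / ar2_mass a1 a2 * cos (of_int (s - t) * x))"
        unfolding ar2_density_mult_poly .
    qed
    also have "\<dots> = 1 / ar2_mass a1 a2 * (LINT x:{-pi..pi}|lborel. cos (of_int (s - t) * x))"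
      by (rule set_integral_mult_right)
    finally show ?thesis unfolding set_integral_cos_int by simp
  qed
  have z_st: "weakly_stationary ?M (sign_process z)"
    by (rule weakly_stationary_sign_process[where w=z and \<gamma>="ar2_cov a1 a2", OF law z_cont z_bd z_prod])
  have e_st: "weakly_stationary ?M (sign_process e)"
    by (rule weakly_stationary_sign_process[where w=e and \<gamma>="\<lambda>h. if h = 0 then 2 * pi / ar2_mass a1 a2 else 0", OF law e_cont e_bd e_prod])
  have "white_noise ?M (sign_process e)"
    unfolding white_noise_def
  proof (intro conjI allI e_st exI[of _ "2 * pi / ar2_mass a1 a2"])
    show "0 < 2 * pi / ar2_mass a1 a2" using ar2_mass_pos by simp
    show "(LINT x|?M. sign_process e t x) = 0" for t
      by (rule sign_process_mean[where w=e, OF law e_cont e_bd])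
    show "covariance ?M (sign_process e s) (sign_process e t) = (if s = t then 2 * pi / ar2_mass a1 a2 else 0)" for s t
      by (subst sign_process_covariance[where w=e, OF law e_cont e_bd]) (simp add: e_prod)
  qed
  moreover have "sign_process z t x = a1 * sign_process z (t - 1) x + a2 * sign_process z (t - 2) x + sign_process e t x" for t x
    by (simp add: sign_process_def e_def algebra_simps)
  ultimately have "stationary_AR2 ?M (sign_process z)"
    unfolding stationary_AR2_def using z_st by blast
  moreover have "has_spectral_density ?M (sign_process z) (restrict ?f {-pi..pi})"
    unfolding has_spectral_density_def
    by (simp add: sign_process_covariance[where w=z, OF law z_cont z_bd] z_prod fourier_coeff_ar2)
  moreover have "continuous_on {-pi..pi} (restrict ?f {-pi..pi})"
    using continuous_on_subset[OF continuous_ar2_density, of "{-pi..pi}"]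
    by (subst continuous_on_cong[OF refl, where g="?f"]) auto
  ultimately show ?thesis
    using ar2_density_in_F_all unfolding F_AR2_def by blast
qed

end

section \<open>Concentration of the spectral mass\<close>

text \<open>Induction along the Chebyshev recurrence for \<open>cos (n z)\<close>. The bound uses
  the difference of cosines rather than of arguments because, for \<open>y = w\<close>, it vanishes
  at both spectral peaks \<open>w\<close> and \<open>- w\<close>.\<close>

lemma cos_multiple_lipschitz:
  "\<bar>cos (real n * x) - cos (real n * y)\<bar> \<le> 3 ^ n * \<bar>cos x - cos y\<bar>"
proof (induction n rule: less_induct)
  case (less n)
  consider "n = 0" | "n = 1" | m where "n = Suc (Suc m)" by (metis One_nat_def not0_implies_Suc)
  then show ?case
  proof cases
    case 3
    let ?d = "\<bar>cos x - cos y\<bar>"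
    have rec: "cos (real n * z) = 2 * cos z * cos (real (Suc m) * z) - cos (real m * z)" for z
    proof -
      have a: "real n * z = real (Suc m) * z + z" and b: "real m * z = real (Suc m) * z - z"
        using 3 by (simp_all add: algebra_simps)
      show ?thesis unfolding a b cos_add cos_diff by simp
    qed
    have ih1: "\<bar>cos (real (Suc m) * x) - cos (real (Suc m) * y)\<bar> \<le> 3 ^ Suc m * ?d"
      by (rule less.IH) (use 3 in simp)
    have ih2: "\<bar>cos (real m * x) - cos (real m * y)\<bar> \<le> 3 ^ m * ?d"
      by (rule less.IH) (use 3 in simp)
    have "cos (real n * x) - cos (real n * y)
        = 2 * (cos x * (cos (real (Suc m) * x) - cos (real (Suc m) * y)))
          + 2 * ((cos x - cos y) * cos (real (Suc m) * y)) - (cos (real m * x) - cos (real m * y))"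
      unfolding rec by (simp add: algebra_simps)
    also have "\<bar>\<dots>\<bar> \<le> 2 * \<bar>cos x * (cos (real (Suc m) * x) - cos (real (Suc m) * y))\<bar>
        + 2 * \<bar>(cos x - cos y) * cos (real (Suc m) * y)\<bar> + \<bar>cos (real m * x) - cos (real m * y)\<bar>"
      by linarith
    also have "\<dots> \<le> 2 * (3 ^ Suc m * ?d) + 2 * ?d + 3 ^ m * ?d"
    proof (intro add_mono mult_left_mono)
      have "\<bar>cos x * (cos (real (Suc m) * x) - cos (real (Suc m) * y))\<bar>
          \<le> 1 * \<bar>cos (real (Suc m) * x) - cos (real (Suc m) * y)\<bar>"
        unfolding abs_mult by (intro mult_right_mono) auto
      then show "\<bar>cos x * (cos (real (Suc m) * x) - cos (real (Suc m) * y))\<bar> \<le> 3 ^ Suc m * ?d"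
        using ih1 by simp
      show "\<bar>(cos x - cos y) * cos (real (Suc m) * y)\<bar> \<le> ?d"
        unfolding abs_mult by (intro mult_left_le) auto
      show "\<bar>cos (real m * x) - cos (real m * y)\<bar> \<le> 3 ^ m * ?d" by (fact ih2)
    qed auto
    \<comment> \<open>The base 3 leaves enough room: \<open>7 * 3 ^ m + 2 \<le> 9 * 3 ^ m\<close>,
      and \<open>9 * 3 ^ m\<close> is \<open>3 ^ n\<close>.\<close>
    also have "\<dots> = (7 * 3 ^ m + 2) * ?d" by (simp add: algebra_simps)
    also have "\<dots> \<le> 3 ^ n * ?d"
      using 3 by (intro mult_right_mono) auto
    finally show ?thesis .
  qed auto
qed

text \<open>With these coefficients the autoregressive polynomial is
  \<open>(1 - \<rho> exp (\<i> w) z) (1 - \<rho> exp (- \<i> w) z)\<close>; the factors on the right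
  are the squared moduli at \<open>z = exp (- \<i> x)\<close>.\<close>

lemma ar2_poly_factor:
  "ar2_poly (2 * \<rho> * cos w) (- \<rho>\<^sup>2) x
     = (1 - 2 * \<rho> * cos (x - w) + \<rho>\<^sup>2) * (1 - 2 * \<rho> * cos (x + w) + \<rho>\<^sup>2)"
proof -
  have "(sin x)\<^sup>2 = 1 - (cos x)\<^sup>2" "(sin w)\<^sup>2 = 1 - (cos w)\<^sup>2"
    by (simp_all add: sin_squared_eq)
  then show ?thesis
    unfolding ar2_poly_def cos_double sin_double cos_diff cos_add by algebra
qed

text \<open>\<open>1 - 2 * \<rho> * cos x + \<rho>\<^sup>2\<close> is the squared distance from 1 to
  \<open>\<rho> exp (\<i> x)\<close>, a distance of at least \<open>1 - \<rho>\<close>. The second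
  bound reflects the triangle inequality: moving on to \<open>exp (\<i> x)\<close> adds at most
  \<open>1 - \<rho>\<close>, so the distance at most doubles.\<close>

lemma ar2_factor_lower:
  fixes \<rho> :: real
  assumes "0 \<le> \<rho>" "\<rho> \<le> 1"
  shows "(1 - \<rho>)\<^sup>2 \<le> 1 - 2 * \<rho> * cos x + \<rho>\<^sup>2"
    and "2 * (1 - cos x) \<le> 4 * (1 - 2 * \<rho> * cos x + \<rho>\<^sup>2)"
proof -
  have eq: "1 - 2 * \<rho> * cos x + \<rho>\<^sup>2 = (1 - \<rho>)\<^sup>2 + 2 * \<rho> * (1 - cos x)"
    by (simp add: power2_eq_square algebra_simps)
  have "0 \<le> 2 * \<rho> * (1 - cos x)" using assms by simp
  then show "(1 - \<rho>)\<^sup>2 \<le> 1 - 2 * \<rho> * cos x + \<rho>\<^sup>2" unfolding eq by simp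
  have "4 * (1 - 2 * \<rho> * cos x + \<rho>\<^sup>2) - 2 * (1 - cos x)
      = (1 + cos x) * (2 * (1 - \<rho>)\<^sup>2) + (1 - cos x) * (2 * \<rho>\<^sup>2 + 4 * \<rho>)"
    by (simp add: power2_eq_square algebra_simps)
  moreover have "0 \<le> 1 + cos x" using cos_ge_minus_one[of x] by linarith
  then have "0 \<le> (1 + cos x) * (2 * (1 - \<rho>)\<^sup>2)" by simp
  moreover have "0 \<le> (1 - cos x) * (2 * \<rho>\<^sup>2 + 4 * \<rho>)"
    using assms by (intro mult_nonneg_nonneg) auto
  ultimately show "2 * (1 - cos x) \<le> 4 * (1 - 2 * \<rho> * cos x + \<rho>\<^sup>2)" by linarith
qed

lemma ar2_poly_pos:
  fixes \<rho> :: real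
  assumes "0 \<le> \<rho>" "\<rho> < 1"
  shows "0 < ar2_poly (2 * \<rho> * cos w) (- \<rho>\<^sup>2) x"
proof -
  have "0 < 1 - 2 * \<rho> * cos y + \<rho>\<^sup>2" for y
  proof (rule less_le_trans)
    show "0 < (1 - \<rho>)\<^sup>2" using assms by simp
    show "(1 - \<rho>)\<^sup>2 \<le> 1 - 2 * \<rho> * cos y + \<rho>\<^sup>2" using assms by (intro ar2_factor_lower(1)) auto
  qed
  then show ?thesis unfolding ar2_poly_factor by simp
qed

text \<open>Both sides factor over the peaks \<open>w\<close> and \<open>- w\<close>, and
  \<open>ar2_factor_lower\<close> compares the factors. Multiplied by the density, the right side
  becomes a constant divided by the mass, so a large mass makes \<open>cos x - cos w\<close> small
  on average.\<close>

lemma sq_diff_cos_le_ar2_poly: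
  fixes \<rho> :: real
  assumes "0 \<le> \<rho>" "\<rho> \<le> 1"
  shows "(cos x - cos w)\<^sup>2 \<le> 4 * ar2_poly (2 * \<rho> * cos w) (- \<rho>\<^sup>2) x"
proof -
  have "4 * (cos x - cos w)\<^sup>2 = (2 * (1 - cos (x - w))) * (2 * (1 - cos (x + w)))"
  proof -
    have "(sin x)\<^sup>2 = 1 - (cos x)\<^sup>2" "(sin w)\<^sup>2 = 1 - (cos w)\<^sup>2"
      by (simp_all add: sin_squared_eq)
    then show ?thesis unfolding cos_diff cos_add by algebra
  qed
  also have "\<dots> \<le> (4 * (1 - 2 * \<rho> * cos (x - w) + \<rho>\<^sup>2)) * (4 * (1 - 2 * \<rho> * cos (x + w) + \<rho>\<^sup>2))"
    using order_trans[OF zero_le_power2 ar2_factor_lower(1)[OF assms]]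
    by (intro mult_mono ar2_factor_lower(2)[OF assms] mult_nonneg_nonneg) auto
  also have "\<dots> = 16 * ar2_poly (2 * \<rho> * cos w) (- \<rho>\<^sup>2) x" unfolding ar2_poly_factor by algebra
  finally show ?thesis by simp
qed

lemma one_minus_cos_le: "2 * (1 - cos t) \<le> (t :: real)\<^sup>2"
proof -
  have "2 * (1 - cos t) = (2 * sin (t / 2))\<^sup>2"
    using cos_double_sin[of "t / 2"] by (simp add: power2_eq_square)
  also have "\<dots> \<le> t\<^sup>2"
    using abs_sin_x_le_abs_x[of "t / 2"] by (intro abs_le_square_iff[THEN iffD1]) simp
  finally show ?thesis .
qed

text \<open>On an interval of length \<open>1 - \<rho>\<close> ending at the peak,
  \<open>ar2_poly\<close> is at most \<open>8 * (1 - \<rho>)\<^sup>2\<close>: the factor of this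
  peak is at most \<open>2 * (1 - \<rho>)\<^sup>2\<close>, the other one at most 4. The bounds on
  \<open>w\<close> keep the interval inside the range of integration.\<close>

lemma ar2_mass_ge:
  fixes \<rho> :: real
  assumes "0 \<le> \<rho>" "\<rho> < 1" "1 - \<rho> \<le> w" "w \<le> pi"
  shows "1 / (8 * (1 - \<rho>)) \<le> ar2_mass (2 * \<rho> * cos w) (- \<rho>\<^sup>2)"
proof -
  let ?P = "ar2_poly (2 * \<rho> * cos w) (- \<rho>\<^sup>2)"
  note P = ar2_poly_pos[OF assms(1,2), of w]
  have d: "0 < 1 - \<rho>" using assms by simp
  have sub: "{w - (1 - \<rho>)..w} \<subseteq> {-pi..pi}" using assms by auto
  have bd: "1 / (8 * (1 - \<rho>)\<^sup>2) \<le> 1 / ?P x" if "x \<in> {w - (1 - \<rho>)..w}" for x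
  proof -
    have "\<bar>x - w\<bar> \<le> \<bar>1 - \<rho>\<bar>" using that d by auto
    then have "(x - w)\<^sup>2 \<le> (1 - \<rho>)\<^sup>2" by (simp only: abs_le_square_iff)
    have "1 - 2 * \<rho> * cos (x - w) + \<rho>\<^sup>2 = (1 - \<rho>)\<^sup>2 + \<rho> * (2 * (1 - cos (x - w)))"
      by (simp add: power2_eq_square algebra_simps)
    also have "\<dots> \<le> (1 - \<rho>)\<^sup>2 + 1 * (x - w)\<^sup>2"
      using assms one_minus_cos_le by (intro add_left_mono mult_mono) auto
    also have "\<dots> \<le> 2 * (1 - \<rho>)\<^sup>2" using \<open>(x - w)\<^sup>2 \<le> (1 - \<rho>)\<^sup>2\<close> by simp
    finally have 1: "1 - 2 * \<rho> * cos (x - w) + \<rho>\<^sup>2 \<le> 2 * (1 - \<rho>)\<^sup>2" .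
    have "\<bar>\<rho> * cos (x + w)\<bar> \<le> 1 * 1"
      unfolding abs_mult using assms by (intro mult_mono) auto
    then have "\<rho> * cos (x + w) \<ge> - 1" by linarith
    moreover have "\<rho>\<^sup>2 \<le> 1" using assms by (intro power_le_one) auto
    ultimately have 2: "1 - 2 * \<rho> * cos (x + w) + \<rho>\<^sup>2 \<le> 4" by linarith
    have "?P x \<le> (2 * (1 - \<rho>)\<^sup>2) * 4"
      unfolding ar2_poly_factor
      by (rule mult_mono[OF 1 2]) (use order_trans[OF _ ar2_factor_lower(1), of 0 \<rho>] assms in auto)
    then show ?thesis using P[of x] d by (intro divide_left_mono mult_pos_pos) auto
  qed
  have "1 / (8 * (1 - \<rho>)) = (1 - \<rho>) * (1 / (8 * (1 - \<rho>)\<^sup>2))"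
    using d by (simp add: power2_eq_square)
  also have "\<dots> = (LINT x:{w - (1 - \<rho>)..w}|lborel. 1 / (8 * (1 - \<rho>)\<^sup>2))"
    using d by (simp add: set_lebesgue_integral_def)
  also have "\<dots> \<le> (LINT x:{w - (1 - \<rho>)..w}|lborel. 1 / ?P x)"
    by (intro set_integral_mono bd borel_integrable_atLeastAtMost' continuous_on_const
        continuous_on_subset[OF continuous_inverse_ar2_poly[OF P]]) auto
  also have "\<dots> \<le> (LINT x:{-pi..pi}|lborel. 1 / ?P x)"
    unfolding set_lebesgue_integral_def
  proof (rule integral_mono)
    show int: "integrable lborel (\<lambda>x. indicator {-pi..pi} x *\<^sub>R (1 / ?P x))"
      using continuous_imp_set_integrable[OF continuous_inverse_ar2_poly[OF P]] by (simp add: set_integrable_def)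
    show "integrable lborel (\<lambda>x. indicator {w - (1 - \<rho>)..w} x *\<^sub>R (1 / ?P x))"
      using borel_integrable_atLeastAtMost'[OF continuous_on_subset[OF continuous_inverse_ar2_poly[OF P]]]
      by (simp add: set_integrable_def)
    show "indicator {w - (1 - \<rho>)..w} x *\<^sub>R (1 / ?P x) \<le> indicator {-pi..pi} x *\<^sub>R (1 / ?P x)" for x
      using sub P[of x] by (auto simp: indicator_def less_imp_le)
  qed
  finally show ?thesis by (simp add: ar2_mass_def)
qed

text \<open>The covariance is the mean of \<open>cos (h x)\<close> under a probability density, so
  its distance from \<open>cos (h w)\<close> is at most a Lipschitz constant times the mean of
  \<open>\<bar>cos x - cos w\<bar>\<close>.\<close>

lemma ar2_cov_approx:
  fixes \<rho> :: real
  assumes "0 \<le> \<rho>" "\<rho> < 1" "1 - \<rho> \<le> w" "w \<le> pi"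
  shows "\<bar>ar2_cov (2 * \<rho> * cos w) (- \<rho>\<^sup>2) h - cos (of_int h * w)\<bar>
    \<le> 3 ^ nat \<bar>h\<bar> * ((1 + 64 * pi) * sqrt (1 - \<rho>))"
proof -
  let ?P = "ar2_poly (2 * \<rho> * cos w) (- \<rho>\<^sup>2)"
  let ?f = "ar2_density (2 * \<rho> * cos w) (- \<rho>\<^sup>2)"
  let ?m = "ar2_mass (2 * \<rho> * cos w) (- \<rho>\<^sup>2)"
  note P = ar2_poly_pos[OF assms(1,2), of w]
  note f_cont = continuous_ar2_density[OF P]
  note f_pos = ar2_density_pos[OF P]
  \<comment> \<open>Balances the two terms of the bound
    \<open>\<bar>u\<bar> \<le> d + u\<^sup>2 / d\<close> after integration: the second one
    contributes \<open>4 / d * (2 * pi / ?m)\<close>, which is at most \<open>64 * pi * d\<close>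
    because \<open>?m\<close> is at least \<open>1 / (8 * d\<^sup>2)\<close>.\<close>
  define d where "d = sqrt (1 - \<rho>)"
  have d: "0 < d" "d\<^sup>2 = 1 - \<rho>" using assms by (simp_all add: d_def)
  have P_cont: "continuous_on UNIV ?P" by (rule continuous_ar2_poly)
  have lip: "\<bar>cos (of_int h * x) - cos (of_int h * w)\<bar> \<le> 3 ^ nat \<bar>h\<bar> * \<bar>cos x - cos w\<bar>" for x
    using cos_multiple_lipschitz[of "nat \<bar>h\<bar>" x w] by (cases "h \<ge> 0") simp_all
  have bd: "\<bar>cos x - cos w\<bar> \<le> d + 4 / d * ?P x" for x
  proof -
    have "\<bar>cos x - cos w\<bar> \<le> d + (cos x - cos w)\<^sup>2 / d"
    proof (cases "\<bar>cos x - cos w\<bar> \<le> d")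
      case False
      then have "\<bar>cos x - cos w\<bar> * d \<le> \<bar>cos x - cos w\<bar> * \<bar>cos x - cos w\<bar>" by (intro mult_left_mono) auto
      then have "\<bar>cos x - cos w\<bar> \<le> (cos x - cos w)\<^sup>2 / d"
        using d by (simp add: pos_le_divide_eq power2_eq_square)
      then show ?thesis using d by linarith
    qed (use d in \<open>simp add: add_increasing2\<close>)
    also have "\<dots> \<le> d + (4 * ?P x) / d"
      using sq_diff_cos_le_ar2_poly[of \<rho> x w] assms d by (intro add_left_mono divide_right_mono) auto
    finally show ?thesis by simp
  qed
  have "ar2_cov (2 * \<rho> * cos w) (- \<rho>\<^sup>2) h - cos (of_int h * w)
      = (LINT x:{-pi..pi}|lborel. ?f x * cos (of_int h * x)) - cos (of_int h * w) * (LINT x:{-pi..pi}|lborel. ?f x)"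
    by (simp add: ar2_density_integral[OF P] ar2_cov_def)
  also have "\<dots> = (LINT x:{-pi..pi}|lborel. ?f x * cos (of_int h * x) - cos (of_int h * w) * ?f x)"
    unfolding set_integral_mult_right[symmetric]
    by (intro set_integral_diff(2)[symmetric] continuous_imp_set_integrable continuous_intros f_cont)
  finally have "\<bar>ar2_cov (2 * \<rho> * cos w) (- \<rho>\<^sup>2) h - cos (of_int h * w)\<bar>
      = \<bar>LINT x:{-pi..pi}|lborel. ?f x * cos (of_int h * x) - cos (of_int h * w) * ?f x\<bar>"
    by (rule arg_cong)
  also have "\<dots> \<le> (LINT x:{-pi..pi}|lborel. \<bar>?f x * cos (of_int h * x) - cos (of_int h * w) * ?f x\<bar>)"
    unfolding real_norm_def[symmetric]
    by (intro set_integral_norm_bound continuous_imp_set_integrable continuous_intros f_cont)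
  also have "\<dots> \<le> (LINT x:{-pi..pi}|lborel. 3 ^ nat \<bar>h\<bar> * (d * ?f x + 4 / d * (1 / ?m)))"
  proof (rule set_integral_mono)
    fix x
    have "\<bar>?f x * cos (of_int h * x) - cos (of_int h * w) * ?f x\<bar> = ?f x * \<bar>cos (of_int h * x) - cos (of_int h * w)\<bar>"
    proof -
      have "?f x * cos (of_int h * x) - cos (of_int h * w) * ?f x = ?f x * (cos (of_int h * x) - cos (of_int h * w))"
        by (simp add: algebra_simps)
      then show ?thesis using f_pos[of x] by (simp only: abs_mult abs_of_pos)
    qed
    also have "\<dots> \<le> ?f x * (3 ^ nat \<bar>h\<bar> * (d + 4 / d * ?P x))"
      using f_pos[of x] bd[of x] by (intro mult_left_mono order_trans[OF lip]) auto
    also have "\<dots> = 3 ^ nat \<bar>h\<bar> * (d * ?f x + 4 / d * (?f x * ?P x))"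
      by (simp add: algebra_simps)
    finally show "\<bar>?f x * cos (of_int h * x) - cos (of_int h * w) * ?f x\<bar> \<le> 3 ^ nat \<bar>h\<bar> * (d * ?f x + 4 / d * (1 / ?m))"
      unfolding ar2_density_mult_poly[OF P] .
  qed (intro continuous_imp_set_integrable continuous_intros f_cont)+
  also have "\<dots> = 3 ^ nat \<bar>h\<bar> * (d + 4 / d * (2 * pi / ?m))"
  proof -
    have "(LINT x:{-pi..pi}|lborel. d * ?f x + 4 / d * (1 / ?m))
        = (LINT x:{-pi..pi}|lborel. d * ?f x) + (LINT x:{-pi..pi}|lborel. 4 / d * (1 / ?m))"
      by (intro set_integral_add(2) continuous_imp_set_integrable continuous_intros f_cont)
    also have "\<dots> = d * (LINT x:{-pi..pi}|lborel. ?f x) + 2 * pi * (4 / d * (1 / ?m))"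
      by (simp only: set_integral_mult_right set_integral_const_pi) simp
    finally show ?thesis by (simp only: set_integral_mult_right ar2_density_integral[OF P]) simp
  qed
  also have "\<dots> \<le> 3 ^ nat \<bar>h\<bar> * ((1 + 64 * pi) * d)"
  proof (intro mult_left_mono)
    have "1 / (8 * d\<^sup>2) \<le> ?m" using ar2_mass_ge[OF assms] by (simp only: d(2))
    moreover have "0 < d\<^sup>2" using d(1) by simp
    ultimately have m: "1 \<le> ?m * (8 * d\<^sup>2)" "0 < ?m"
      using ar2_mass_pos[OF P] by (simp_all only: pos_divide_le_eq mult_pos_pos zero_less_numeral)
    have "4 / d * (2 * pi / ?m) = 8 * pi * (1 / (d * ?m))" by simp
    also have "1 / (d * ?m) \<le> 8 * d"
      using m d by (simp add: field_simps power2_eq_square)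
    finally show "d + 4 / d * (2 * pi / ?m) \<le> (1 + 64 * pi) * d"
      by (simp add: algebra_simps)
  qed simp
  finally show ?thesis unfolding d_def .
qed

section \<open>Covariance matrices of autoregressive densities\<close>

lemma pos_strict_mono: "i < j \<Longrightarrow> pos i < pos j"
  unfolding pos_def by (intro psubset_card_mono) auto

lemma pos_eq_iff [simp]: "pos i = pos j \<longleftrightarrow> i = j"
  using pos_strict_mono[of i j] pos_strict_mono[of j i] by (cases i j rule: linorder_cases) auto

lemma pos_ge_1: "1 \<le> pos i"
  using card_mono[of "{..i}" "{i}"] by (simp add: pos_def)

lemma pos_le_CARD: "pos (i :: 'i::{finite,linorder}) \<le> CARD('i)"
  unfolding pos_def by (intro card_mono) auto

lemma bij_betw_pos: "bij_betw pos (UNIV :: 'i::{finite,linorder} set) {1..CARD('i)}"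
proof -
  have inj: "inj (pos :: 'i \<Rightarrow> nat)" by (simp add: inj_def)
  moreover have "range (pos :: 'i \<Rightarrow> nat) = {1..CARD('i)}"
    by (rule card_subset_eq) (use pos_ge_1 pos_le_CARD in \<open>auto simp: card_image[OF inj]\<close>)
  ultimately show ?thesis by (simp add: bij_betw_def)
qed

lemma obtain_pos:
  assumes "1 \<le> m" "m \<le> CARD('i::{finite,linorder})"
  obtains i :: "'i::{finite,linorder}" where "pos i = m"
proof -
  have "m \<in> range (pos :: 'i \<Rightarrow> nat)"
    using bij_betw_pos[where 'i='i] assms by (simp add: bij_betw_def)
  then show ?thesis using that by blast
qed

lemma Sigma_mat_ar2:
  assumes "\<And>x. 0 < ar2_poly a1 a2 x"
  shows "Sigma_mat (restrict (ar2_density a1 a2) {-pi..pi}) $ i $ j = ar2_cov a1 a2 (int (pos i) - int (pos j))"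
  by (simp add: Sigma_mat_def fourier_coeff_ar2[OF assms])

lemma ar2_cov_minus: "ar2_cov a1 a2 (- h) = ar2_cov a1 a2 h"
  by (simp add: ar2_cov_def)

lemma set_integral_sum:
  fixes f :: "'i \<Rightarrow> 'a \<Rightarrow> real"
  assumes "\<And>i. i \<in> I \<Longrightarrow> set_integrable M A (f i)"
  shows "(LINT x:A|M. \<Sum>i\<in>I. f i x) = (\<Sum>i\<in>I. LINT x:A|M. f i x)"
  using assms unfolding set_lebesgue_integral_def set_integrable_def scaleR_sum_right
  by (rule Bochner_Integration.integral_sum)

text \<open>The density is bounded below by a positive constant, so the form dominates that of white
  noise, a positive multiple of the squared norm.\<close>

lemma ar2_cov_pos_def:
  fixes x :: "real ^ 'n::{finite,linorder}"
  assumes P: "\<And>x. 0 < ar2_poly a1 a2 x" and "x \<noteq> 0"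
  shows "0 < (\<Sum>i\<in>UNIV. \<Sum>j\<in>UNIV. x $ i * x $ j * ar2_cov a1 a2 (int (pos i) - int (pos j)))"
proof -
  let ?f = "ar2_density a1 a2" and ?m = "ar2_mass a1 a2"
  let ?K = "2 * (1 + \<bar>a1\<bar> + \<bar>a2\<bar>)\<^sup>2"
  let ?h = "\<lambda>i j :: 'n. int (pos i) - int (pos j)"
  define S where "S y = (\<Sum>i\<in>UNIV. \<Sum>j\<in>UNIV. x $ i * x $ j * cos (of_int (?h i j) * y))" for y
  \<comment> \<open>\<open>S y\<close> is the squared modulus of the trigonometric polynomial with
    coefficients \<open>x\<close>.\<close>
  have S_nonneg: "0 \<le> S y" for y
  proof -
    have "S y = (\<Sum>i\<in>UNIV. \<Sum>j\<in>UNIV. (x $ i * cos (pos i * y)) * (x $ j * cos (pos j * y))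
        + (x $ i * sin (pos i * y)) * (x $ j * sin (pos j * y)))"
      unfolding S_def by (intro sum.cong refl) (simp add: left_diff_distrib cos_diff algebra_simps)
    also have "\<dots> = (\<Sum>i\<in>UNIV. x $ i * cos (pos i * y))\<^sup>2 + (\<Sum>i\<in>UNIV. x $ i * sin (pos i * y))\<^sup>2"
      by (simp add: power2_eq_square sum_product sum.distrib)
    finally show ?thesis by simp
  qed
  have S_cont: "continuous_on UNIV S" unfolding S_def by (intro continuous_intros)
  have int: "(LINT y:{-pi..pi}|lborel. g y * S y)
      = (\<Sum>i\<in>UNIV. \<Sum>j\<in>UNIV. x $ i * x $ j * (LINT y:{-pi..pi}|lborel. g y * cos (of_int (?h i j) * y)))"
    if g: "continuous_on UNIV g" for g :: "real \<Rightarrow> real"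
  proof -
    have "(LINT y:{-pi..pi}|lborel. g y * S y)
      = (LINT y:{-pi..pi}|lborel. (\<Sum>i\<in>UNIV. \<Sum>j\<in>UNIV. x $ i * x $ j * (g y * cos (of_int (?h i j) * y))))"
      by (simp add: S_def sum_distrib_left mult_ac)
    also have "\<dots> = (\<Sum>i\<in>UNIV. (LINT y:{-pi..pi}|lborel. (\<Sum>j\<in>UNIV. x $ i * x $ j * (g y * cos (of_int (?h i j) * y)))))"
      by (intro set_integral_sum continuous_imp_set_integrable continuous_intros g)
    also have "\<dots> = (\<Sum>i\<in>UNIV. \<Sum>j\<in>UNIV. (LINT y:{-pi..pi}|lborel. x $ i * x $ j * (g y * cos (of_int (?h i j) * y))))"
      by (intro sum.cong refl set_integral_sum continuous_imp_set_integrable continuous_intros g)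
    finally show ?thesis by (simp only: set_integral_mult_right)
  qed
  have K: "0 < ?K" by (intro mult_pos_pos zero_less_power) auto
  have f_ge: "1 / (?m * ?K) \<le> ?f y" for y
    unfolding ar2_density_def using ar2_poly_le[of a1 a2 y] P[of y] ar2_mass_pos[OF P] K
    by (intro divide_left_mono mult_left_mono mult_pos_pos) auto
  \<comment> \<open>For a constant weight the cosine integrals vanish off the diagonal, since
    distinct indices have distinct numbers.\<close>
  have eq: "(\<Sum>j\<in>UNIV. x $ i * x $ j * (LINT y:{-pi..pi}|lborel. 1 / (?m * ?K) * cos (of_int (?h i j) * y)))
      = 1 / (?m * ?K) * (2 * pi) * (x $ i * x $ i)" for i
  proof -
    have "(\<Sum>j\<in>UNIV. x $ i * x $ j * (LINT y:{-pi..pi}|lborel. 1 / (?m * ?K) * cos (of_int (?h i j) * y)))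
       = (\<Sum>j\<in>UNIV. if j = i then 1 / (?m * ?K) * (2 * pi) * (x $ i * x $ i) else 0)"
      unfolding set_integral_mult_right set_integral_cos_int by (intro sum.cong refl) auto
    then show ?thesis by simp
  qed
  obtain k where "x $ k \<noteq> 0" using \<open>x \<noteq> 0\<close> by (auto simp: vec_eq_iff)
  then have "0 < x $ k * x $ k" using not_real_square_gt_zero by blast
  then have "0 < (\<Sum>i\<in>UNIV. x $ i * x $ i)"
    by (intro sum_pos2[of _ k]) auto
  then have "0 < (\<Sum>i\<in>UNIV. 1 / (?m * ?K) * (2 * pi) * (x $ i * x $ i))"
    unfolding sum_distrib_left[symmetric] using K ar2_mass_pos[OF P] by simp
  also have "\<dots> = (LINT y:{-pi..pi}|lborel. 1 / (?m * ?K) * S y)"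
    unfolding int[OF continuous_on_const] eq ..
  also have "\<dots> \<le> (LINT y:{-pi..pi}|lborel. ?f y * S y)"
    by (intro set_integral_mono mult_right_mono f_ge S_nonneg continuous_imp_set_integrable continuous_intros
        S_cont continuous_ar2_density[OF P])
  also have "\<dots> = (\<Sum>i\<in>UNIV. \<Sum>j\<in>UNIV. x $ i * x $ j * ar2_cov a1 a2 (?h i j))"
    unfolding int[OF continuous_ar2_density[OF P]] ar2_cov_def ..
  finally show ?thesis .
qed

lemma Sigma_mat_ar2_factor:
  assumes P: "\<And>x. 0 < ar2_poly a1 a2 x" and "0 < s"
  shows "\<exists>B :: real ^ 'n::{finite,linorder} ^ 'n::{finite,linorder}. B ** transpose B = s *\<^sub>R Sigma_mat (restrict (ar2_density a1 a2) {-pi..pi})"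
proof (rule matrix_factor_exists)
  fix i j :: "'n::{finite,linorder}"
  show "(s *\<^sub>R Sigma_mat (restrict (ar2_density a1 a2) {-pi..pi})) $ i $ j = (s *\<^sub>R Sigma_mat (restrict (ar2_density a1 a2) {-pi..pi})) $ j $ i"
    using ar2_cov_minus[of a1 a2 "int (pos i) - int (pos j)"] by (simp add: Sigma_mat_ar2[OF P])
next
  fix x :: "real ^ 'n::{finite,linorder}" assume "x \<noteq> 0"
  have "0 < s * (\<Sum>i\<in>UNIV. \<Sum>j\<in>UNIV. x $ i * x $ j * ar2_cov a1 a2 (int (pos i) - int (pos j)))"
    using ar2_cov_pos_def[OF P \<open>x \<noteq> 0\<close>] \<open>0 < s\<close> by simp
  then show "0 < (\<Sum>i\<in>UNIV. \<Sum>j\<in>UNIV. x $ i * x $ j * (s *\<^sub>R Sigma_mat (restrict (ar2_density a1 a2) {-pi..pi})) $ i $ j)"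
    by (simp add: Sigma_mat_ar2[OF P] sum_distrib_left mult_ac)
qed

text \<open>A nonzero kernel vector of \<open>transpose B\<close> would annihilate the positive
  definite form. The claim covers every root because the one in \<open>gaussian_measure\<close> is
  fixed only by choice.\<close>

lemma Sigma_mat_ar2_factor_invertible:
  fixes B :: "real ^ 'n::{finite,linorder} ^ 'n::{finite,linorder}"
  assumes P: "\<And>x. 0 < ar2_poly a1 a2 x" and "0 < s"
    and B: "B ** transpose B = s *\<^sub>R Sigma_mat (restrict (ar2_density a1 a2) {-pi..pi})"
  shows "invertible B"
proof -
  have "x = 0" if "transpose B *v x = 0" for x
  proof (rule ccontr)
    assume "x \<noteq> 0"
    have "0 < s * (\<Sum>i\<in>UNIV. \<Sum>j\<in>UNIV. x $ i * x $ j * ar2_cov a1 a2 (int (pos i) - int (pos j)))"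
      using ar2_cov_pos_def[OF P \<open>x \<noteq> 0\<close>] \<open>0 < s\<close> by simp
    also have "\<dots> = x \<bullet> ((s *\<^sub>R Sigma_mat (restrict (ar2_density a1 a2) {-pi..pi})) *v x)"
      by (simp add: inner_vec_def matrix_vector_mult_def Sigma_mat_ar2[OF P] sum_distrib_left mult_ac)
    also have "\<dots> = x \<bullet> (B *v (transpose B *v x))"
      by (simp only: B[symmetric] matrix_vector_mul_assoc)
    finally show False using that by simp
  qed
  then have "inj ((*v) (transpose B))" by (simp add: matrix_left_invertible_injective[symmetric] matrix_left_invertible_ker)
  then have "invertible (transpose B)"
    by (simp add: matrix_left_invertible_injective[symmetric] invertible_left_inverse)
  then show ?thesis by (simp add: invertible_det_nz)
qed

section \<open>Divergence of the test statistic\<close>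

lemma mult_matrix_inv:
  assumes "invertible (A :: real ^ 'n ^ 'n)"
  shows "A ** matrix_inv A = mat 1"
  using someI_ex[OF assms[unfolded invertible_def]] by (simp add: matrix_inv_def)

text \<open>Cauchy-Schwarz for the semidefinite form of \<open>A\<close>, applied to
  \<open>w\<close> and \<open>matrix_inv A *v w\<close>. It bounds the statistic from below through
  the covariance estimator itself, without tracking its eigenvalues.\<close>

lemma psd_inverse_cauchy_schwarz:
  fixes A :: "real ^ 'q ^ 'q"
  assumes sym: "transpose A = A" and psd: "\<And>v. 0 \<le> v \<bullet> (A *v v)" and inv: "invertible A"
  shows "(w \<bullet> w)\<^sup>2 \<le> (w \<bullet> (A *v w)) * (w \<bullet> (matrix_inv A *v w))"
proof -
  define u where "u = matrix_inv A *v w"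
  have Au: "A *v u = w"
    by (simp add: u_def matrix_vector_mul_assoc mult_matrix_inv[OF inv])
  define a b c where "a = w \<bullet> u" and "b = w \<bullet> w" and "c = w \<bullet> (A *v w)"
  have uAw: "u \<bullet> (A *v w) = b"
    by (metis Au b_def dot_lmul_matrix sym transpose_matrix_vector)
  have q: "0 \<le> t\<^sup>2 * a - 2 * t * s * b + s\<^sup>2 * c" for t s
  proof -
    have "(t *\<^sub>R u - s *\<^sub>R w) \<bullet> (A *v (t *\<^sub>R u - s *\<^sub>R w)) = t\<^sup>2 * a - 2 * t * s * b + s\<^sup>2 * c"
      by (simp add: matrix_vector_mult_diff_distrib matrix_vector_mult_scaleR Au inner_simps uAw
          a_def b_def c_def inner_commute[of u w] power2_eq_square algebra_simps)
    then show ?thesis using psd by metis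
  qed
  have "0 \<le> a" "0 \<le> c" using q[of 1 0] q[of 0 1] by simp_all
  have "b\<^sup>2 \<le> c * a"
  \<comment> \<open>The discriminant argument, with \<open>t\<close> and \<open>s\<close> chosen to
    avoid division; it needs \<open>a\<close> or \<open>c\<close> positive, so the case where both
    vanish is separate.\<close>
  proof (cases "a = 0 \<and> c = 0")
    case True
    then have "b \<le> 0" using q[of 1 1] by simp
    moreover have "0 \<le> b" by (simp add: b_def)
    ultimately have "b = 0" by simp
    then show ?thesis using True by simp
  next
    case False
    then consider "0 < a" | "0 < c" using \<open>0 \<le> a\<close> \<open>0 \<le> c\<close> by linarith
    then show ?thesis
    proof cases
      case 1
      have "b\<^sup>2 * a - 2 * b * a * b + a\<^sup>2 * c = a * (c * a - b\<^sup>2)" by algebra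
      with q[of b a] 1 show ?thesis by (simp add: zero_le_mult_iff)
    next
      case 2
      have "c\<^sup>2 * a - 2 * c * b * b + b\<^sup>2 * c = c * (c * a - b\<^sup>2)" by algebra
      with q[of c b] 2 show ?thesis by (simp add: zero_le_mult_iff)
    qed
  qed
  then show ?thesis by (simp add: a_def b_def c_def u_def)
qed

lemma cos_taylor_bound: "\<bar>cos x - (\<Sum>m<n. cos_coeff m * x ^ m)\<bar> \<le> \<bar>x\<bar> ^ n"
proof -
  obtain t where "cos x = (\<Sum>m<n. cos_coeff m * x ^ m) + cos (t + 1/2 * real n * pi) / fact n * x ^ n"
    using Maclaurin_cos_expansion[of x n] by blast
  then have "\<bar>cos x - (\<Sum>m<n. cos_coeff m * x ^ m)\<bar> = \<bar>cos (t + 1/2 * real n * pi)\<bar> / fact n * \<bar>x\<bar> ^ n"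
    by (simp add: abs_mult power_abs)
  also have "\<dots> \<le> 1 * \<bar>x\<bar> ^ n"
    using abs_cos_le_one[of "t + 1/2 * real n * pi"] fact_ge_1[of n, where 'a=real]
    by (intro mult_right_mono) (auto simp: divide_le_eq simp del: abs_cos_le_one fact_ge_1)
  finally show ?thesis by simp
qed

lemma sin_taylor_bound: "\<bar>sin x - (\<Sum>m<n. sin_coeff m * x ^ m)\<bar> \<le> \<bar>x\<bar> ^ n"
proof -
  obtain t where "sin x = (\<Sum>m<n. sin_coeff m * x ^ m) + sin (t + 1/2 * real n * pi) / fact n * x ^ n"
    using Maclaurin_sin_expansion[of x n] by blast
  then have "\<bar>sin x - (\<Sum>m<n. sin_coeff m * x ^ m)\<bar> = \<bar>sin (t + 1/2 * real n * pi)\<bar> / fact n * \<bar>x\<bar> ^ n"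
    by (simp add: abs_mult power_abs)
  also have "\<dots> \<le> 1 * \<bar>x\<bar> ^ n"
    using abs_sin_le_one[of "t + 1/2 * real n * pi"] fact_ge_1[of n, where 'a=real]
    by (intro mult_right_mono) (auto simp: divide_le_eq simp del: abs_sin_le_one fact_ge_1)
  finally show ?thesis by simp
qed

lemma bounded_imp_tendsto_zero_scaleR:
  fixes g :: "nat \<Rightarrow> 'a::real_normed_vector"
  assumes "f \<longlonglongrightarrow> 0" and "\<And>m. norm (g m) \<le> B"
  shows "(\<lambda>m. f m *\<^sub>R g m) \<longlonglongrightarrow> 0"
proof (rule tendsto_0_le[OF assms(1), of _ B])
  show "\<forall>\<^sub>F m in sequentially. norm (f m *\<^sub>R g m) \<le> norm (f m) * B"
    using assms(2) by (intro always_eventually allI) (simp add: mult_left_mono)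
qed

lemma continuous_on_quadratic_form:
  assumes "continuous_on UNIV (\<Omega> :: real ^ 'n \<Rightarrow> real ^ 'q ^ 'q)"
  shows "continuous_on UNIV (\<lambda>p. snd p \<bullet> (\<Omega> (fst p) *v snd p))"
proof -
  have "continuous_on UNIV (\<lambda>p :: (real ^ 'n) \<times> (real ^ 'q). \<Omega> (fst p))"
    by (rule continuous_on_compose2[OF assms]) (auto intro: continuous_intros)
  then show ?thesis
    unfolding inner_vec_def matrix_vector_mult_def by (auto intro!: continuous_intros)
qed

text \<open>The deterministic core: one sequence of data close to harmonic paths of vanishing
  frequency. The amplitudes \<open>c\<close> and \<open>s\<close> may vary with \<open>m\<close>,
  since the roots of the covariance matrices do.\<close>

lemma F_type_statistic_eventually_ge:
  fixes X :: "real ^ 'k::{finite,linorder} ^ 'n::{finite,linorder}"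
    and R :: "real ^ 'k::{finite,linorder} ^ 'q"
    and y :: "nat \<Rightarrow> real ^ 'n::{finite,linorder}"
    and w c s :: "nat \<Rightarrow> real"
  assumes trend: "polynomial_trend X R kF"
    and est: "estimator_conditions X \<beta> \<Omega> {}"
    and psd: "\<forall>y v. 0 \<le> v \<bullet> (\<Omega> y *v v)"
    and \<mu>0: "\<mu>0 \<in> M0 X R r"
    and w_pos: "\<And>m. 0 < w m" and w_lim: "w \<longlonglongrightarrow> 0"
    and c_lim: "c \<longlonglongrightarrow> c0" and s_lim: "s \<longlonglongrightarrow> s0" and "c0 \<noteq> 0" "s0 \<noteq> 0"
    and close: "\<And>m t. \<bar>y m $ t - \<mu>0 $ t - (c m * cos (w m * pos t) + s m * sin (w m * pos t))\<bar> \<le> K * w m ^ kF"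
    and inv: "\<And>m. det (\<Omega> (y m)) \<noteq> 0"
  shows "\<forall>\<^sub>F m in sequentially. C \<le> F_type_statistic R r \<beta> \<Omega> {} (y m)"
proof -
  from trend have X: "\<And>t j. pos j \<le> kF \<Longrightarrow> X $ t $ j = real (pos t) ^ (pos j - 1)"
    and kFk: "kF \<le> CARD('k)"
    unfolding polynomial_trend_def by auto
  from est have \<beta>_cont: "continuous_on UNIV \<beta>" and \<Omega>_cont: "continuous_on UNIV \<Omega>"
    and sym: "\<And>y. transpose (\<Omega> y) = \<Omega> y"
    and \<beta>_eq: "\<And>y \<delta> \<eta>. \<delta> \<noteq> 0 \<Longrightarrow> \<beta> (\<delta> *\<^sub>R y + X *v \<eta>) = \<delta> *\<^sub>R \<beta> y + \<eta>"
    and \<Omega>_eq: "\<And>y \<delta> \<eta>. \<delta> \<noteq> 0 \<Longrightarrow> \<Omega> (\<delta> *\<^sub>R y + X *v \<eta>) = \<delta>\<^sup>2 *\<^sub>R \<Omega> y"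
    unfolding estimator_conditions_def by auto
  from \<mu>0 obtain b where b: "\<mu>0 = X *v b" "R *v b = r" by (auto simp: M0_def)
  from trend have "\<exists>i. pos i \<le> kF \<and> column i R \<noteq> 0" unfolding polynomial_trend_def by blast
  then obtain i where i: "pos i \<le> kF" "column i R \<noteq> 0"
    and i_min: "\<And>j. pos j < pos i \<Longrightarrow> column j R = 0"
  proof -
    from \<open>\<exists>i. pos i \<le> kF \<and> column i R \<noteq> 0\<close>
    obtain i where "pos i \<le> kF \<and> column i R \<noteq> 0" "\<forall>j. pos j \<le> kF \<and> column j R \<noteq> 0 \<longrightarrow> pos i \<le> pos j"
      using ex_has_least_nat[of "\<lambda>i. pos i \<le> kF \<and> column i R \<noteq> 0" _ pos] by blast
    then have "column j R = 0" if "pos j < pos i" for j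
      using that by (metis leD le_trans less_imp_le)
    then show ?thesis using that \<open>pos i \<le> kF \<and> column i R \<noteq> 0\<close> by blast
  qed
  \<comment> \<open>Columns are numbered from 1, so column \<open>pos i\<close> holds the power
    \<open>pos i - 1\<close> of time.\<close>
  define p where "p = pos i - 1"
  have p: "p < kF" "pos i = Suc p" using i(1) pos_ge_1[of i] by (auto simp: p_def)

  define a where "a m j = c m * cos_coeff (pos j - 1) + s m * sin_coeff (pos j - 1)" for m and j :: 'k
  define \<eta> where "\<eta> m = (\<chi> j. if pos j \<le> kF then a m j * w m ^ (pos j - 1) else 0)" for m
  \<comment> \<open>The remainder rescaled to unit order. It stays in a fixed ball, so compactness
    bounds \<open>\<beta>\<close> and \<open>\<Omega>\<close> along it.\<close>
  define W where "W m = (1 / w m ^ kF) *\<^sub>R (y m - \<mu>0 - X *v \<eta> m)" for m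
  have w0: "w m ^ l \<noteq> 0" "0 < w m ^ l" for m l using w_pos[of m] by auto
  have y_eq: "y m = w m ^ kF *\<^sub>R W m + X *v (b + \<eta> m)" for m
    using w_pos[of m] by (simp add: W_def b matrix_vector_right_distrib)

  \<comment> \<open>The trend columns reproduce the Taylor polynomial of degree below
    \<open>kF\<close> exactly.\<close>
  have X\<eta>: "(X *v \<eta> m) $ t = (\<Sum>l<kF. (c m * cos_coeff l + s m * sin_coeff l) * (w m * pos t) ^ l)" for m t
  proof -
    let ?g = "\<lambda>l. (c m * cos_coeff l + s m * sin_coeff l) * (w m * pos t) ^ l"
    have "(X *v \<eta> m) $ t = (\<Sum>j\<in>(UNIV :: 'k set). if pos j \<le> kF then ?g (pos j - 1) else 0)"
      unfolding matrix_vector_mult_def vec_lambda_beta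
    proof (rule sum.cong[OF refl])
      fix j
      show "X $ t $ j * \<eta> m $ j = (if pos j \<le> kF then ?g (pos j - 1) else 0)"
        using X[of j t] by (simp add: \<eta>_def a_def power_mult_distrib)
    qed
    also have "\<dots> = (\<Sum>q\<in>{1..CARD('k)}. if q \<le> kF then ?g (q - 1) else 0)"
      by (rule sum.reindex_bij_betw[OF bij_betw_pos])
    also have "\<dots> = (\<Sum>q\<in>{1..kF}. ?g (q - 1))"
      using kFk by (intro sum.mono_neutral_cong_right) auto
    also have "\<dots> = (\<Sum>l<kF. ?g l)"
      by (rule sum.reindex_bij_witness[of _ Suc "\<lambda>q. q - 1"]) auto
    finally show ?thesis .
  qed

  obtain Kc Ks where Kc: "\<And>m. \<bar>c m\<bar> \<le> Kc" and Ks: "\<And>m. \<bar>s m\<bar> \<le> Ks"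
    using c_lim s_lim by (metis convergent_imp_Bseq convergentI Bseq_def real_norm_def)
  define KW where "KW = K + (Kc + Ks) * real CARD('n) ^ kF"
  have W_nth: "\<bar>W m $ t\<bar> \<le> KW" for m t
  proof -
    let ?x = "w m * pos t"
    have x: "\<bar>?x\<bar> ^ kF \<le> w m ^ kF * real CARD('n) ^ kF"
      using w_pos[of m] pos_le_CARD[of t] unfolding power_mult_distrib[symmetric]
      by (intro power_mono) (auto simp: abs_mult)
    define e1 e2 e3 where "e1 = y m $ t - \<mu>0 $ t - (c m * cos ?x + s m * sin ?x)"
      and "e2 = cos ?x - (\<Sum>l<kF. cos_coeff l * ?x ^ l)"
      and "e3 = sin ?x - (\<Sum>l<kF. sin_coeff l * ?x ^ l)"
    have "(y m - \<mu>0 - X *v \<eta> m) $ t = e1 + c m * e2 + s m * e3"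
      by (simp add: X\<eta> e1_def e2_def e3_def algebra_simps sum.distrib sum_distrib_left)
    then have "\<bar>(y m - \<mu>0 - X *v \<eta> m) $ t\<bar> \<le> \<bar>e1\<bar> + \<bar>c m * e2\<bar> + \<bar>s m * e3\<bar>"
      by linarith
    also have "\<dots> \<le> K * w m ^ kF + Kc * (w m ^ kF * real CARD('n) ^ kF) + Ks * (w m ^ kF * real CARD('n) ^ kF)"
      unfolding abs_mult e1_def e2_def e3_def
      using order_trans[OF abs_ge_zero Kc] order_trans[OF abs_ge_zero Ks]
      by (intro add_mono close mult_mono Kc Ks order_trans[OF cos_taylor_bound x] order_trans[OF sin_taylor_bound x]) auto
    also have "\<dots> = KW * w m ^ kF" by (simp add: KW_def algebra_simps)
    finally show ?thesis
      using w0(2)[of m kF] by (simp add: W_def abs_mult divide_le_eq)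
  qed
  define K' where "K' = real CARD('n) * KW"
  have W_norm: "norm (W m) \<le> K'" for m
  proof -
    have "norm (W m) \<le> (\<Sum>t\<in>UNIV. \<bar>W m $ t\<bar>)" by (rule norm_le_l1_cart)
    also have "\<dots> \<le> (\<Sum>t\<in>(UNIV :: 'n set). KW)" by (intro sum_mono W_nth)
    finally show ?thesis by (simp add: K'_def)
  qed

  \<comment> \<open>What is left of \<open>R *v \<beta> (y m) - r\<close> without the factor
    \<open>w m ^ p\<close>: columns of \<open>R\<close> before \<open>i\<close> vanish, column
    \<open>i\<close> keeps its coefficient, and later columns and the remainder carry positive
    powers of \<open>w m\<close>.\<close>
  define u where "u m = (\<Sum>j\<in>UNIV. (if pos i \<le> pos j \<and> pos j \<le> kF then a m j * w m ^ (pos j - pos i) else 0) *\<^sub>R column j R)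
      + w m ^ (kF - p) *\<^sub>R (R *v \<beta> (W m))" for m
  have u: "R *v \<beta> (y m) - r = w m ^ p *\<^sub>R u m" for m
  proof -
    have "R *v \<eta> m = (\<Sum>j\<in>UNIV. \<eta> m $ j *\<^sub>R column j R)"
      by (simp add: matrix_mult_sum scalar_mult_eq_scaleR)
    also have "\<dots> = (\<Sum>j\<in>UNIV. w m ^ p *\<^sub>R ((if pos i \<le> pos j \<and> pos j \<le> kF then a m j * w m ^ (pos j - pos i) else 0) *\<^sub>R column j R))"
    proof (intro sum.cong refl)
      fix j
      show "\<eta> m $ j *\<^sub>R column j R = w m ^ p *\<^sub>R ((if pos i \<le> pos j \<and> pos j \<le> kF then a m j * w m ^ (pos j - pos i) else 0) *\<^sub>R column j R)"
      proof (cases "pos i \<le> pos j")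
        case True
        then have "pos j - 1 = p + (pos j - pos i)" using p by simp
        then have "w m ^ (pos j - 1) = w m ^ p * w m ^ (pos j - pos i)" by (simp only: power_add)
        then show ?thesis using True by (simp add: \<eta>_def del: One_nat_def)
      next
        case False
        then show ?thesis using i_min[of j] by simp
      qed
    qed
    finally have "R *v \<eta> m = (\<Sum>j\<in>UNIV. w m ^ p *\<^sub>R ((if pos i \<le> pos j \<and> pos j \<le> kF then a m j * w m ^ (pos j - pos i) else 0) *\<^sub>R column j R))" .
    moreover have "w m ^ kF = w m ^ p * w m ^ (kF - p)" using p by (simp flip: power_add)
    moreover have "R *v \<beta> (y m) - r = w m ^ kF *\<^sub>R (R *v \<beta> (W m)) + R *v \<eta> m"
      unfolding y_eq[of m] \<beta>_eq[OF w0(1)] by (simp add: matrix_vector_right_distrib b matrix_vector_mult_scaleR)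
    ultimately show ?thesis by (simp add: u_def scaleR_right_distrib scaleR_sum_right)
  qed

  have "bounded (\<beta> ` cball 0 K')"
    by (intro compact_imp_bounded compact_continuous_image continuous_on_subset[OF \<beta>_cont]) auto
  then have "bounded ((*v) R ` \<beta> ` cball 0 K')"
    by (rule bounded_linear_image) (rule matrix_vector_mul_bounded_linear)
  then obtain B\<beta> where "\<forall>x\<in>cball 0 K'. norm (R *v \<beta> x) \<le> B\<beta>"
    by (auto simp: bounded_iff)
  then have B\<beta>: "norm (R *v \<beta> (W m)) \<le> B\<beta>" for m
    using W_norm[of m] by simp
  define a0 where "a0 = c0 * cos_coeff p + s0 * sin_coeff p"
  \<comment> \<open>By parity exactly one of \<open>cos_coeff p\<close> and
    \<open>sin_coeff p\<close> is nonzero, so nonzero \<open>c0\<close> and \<open>s0\<close> cover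
    every degree.\<close>
  have a0: "a0 \<noteq> 0" using \<open>c0 \<noteq> 0\<close> \<open>s0 \<noteq> 0\<close> by (simp add: a0_def cos_coeff_def sin_coeff_def)
  have u_lim: "u \<longlonglongrightarrow> a0 *\<^sub>R column i R"
  proof -
    have "(\<lambda>m. (if pos i \<le> pos j \<and> pos j \<le> kF then a m j * w m ^ (pos j - pos i) else 0))
        \<longlonglongrightarrow> (if j = i then a0 else 0)" for j
    proof (cases "pos i \<le> pos j \<and> pos j \<le> kF")
      case True
      have "(\<lambda>m. a m j * w m ^ (pos j - pos i))
          \<longlonglongrightarrow> (c0 * cos_coeff (pos j - 1) + s0 * sin_coeff (pos j - 1)) * 0 ^ (pos j - pos i)"
        unfolding a_def by (intro tendsto_intros c_lim s_lim w_lim)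
      moreover have "(c0 * cos_coeff (pos j - 1) + s0 * sin_coeff (pos j - 1)) * 0 ^ (pos j - pos i) = (if j = i then a0 else 0)"
        using True by (auto simp: a0_def p_def power_0_left dest: antisym)
      ultimately show ?thesis using True by simp
    next
      case False
      then show ?thesis using i by auto
    qed
    moreover have "(\<lambda>m. w m ^ (kF - p) *\<^sub>R (R *v \<beta> (W m))) \<longlonglongrightarrow> 0"
      by (rule bounded_imp_tendsto_zero_scaleR[OF _ B\<beta>])
        (use tendsto_power[OF w_lim, of "kF - p"] p in \<open>simp add: power_0_left\<close>)
    ultimately have "u \<longlonglongrightarrow> (\<Sum>j\<in>UNIV. (if j = i then a0 else 0) *\<^sub>R column j R) + 0"
      unfolding u_def by (intro tendsto_add tendsto_sum tendsto_scaleR tendsto_const)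
    moreover have "(\<Sum>j\<in>UNIV. (if j = i then a0 else 0) *\<^sub>R column j R) = (\<Sum>j\<in>UNIV. if j = i then a0 *\<^sub>R column j R else 0)"
      by (intro sum.cong) auto
    ultimately show ?thesis by simp
  qed

  \<comment> \<open>The quadratic form in \<open>\<Omega> (y m)\<close> divided by
    \<open>(w m ^ p) ^ 4\<close>. The form has order \<open>2 * kF + 2 * p\<close>, which leaves the
    positive exponent \<open>2 * (kF - p)\<close>.\<close>
  define e where "e m = (w m ^ (kF - p))\<^sup>2 * (u m \<bullet> (\<Omega> (W m) *v u m))" for m
  have e_nonneg: "0 \<le> e m" for m using psd by (simp add: e_def)
  have "convergent u" using u_lim by (rule convergentI)
  then obtain Ku where Ku: "\<And>m. norm (u m) \<le> Ku"
    by (metis convergent_imp_Bseq Bseq_def)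
  have "bounded ((\<lambda>p. snd p \<bullet> (\<Omega> (fst p) *v snd p)) ` (cball 0 K' \<times> cball 0 Ku))"
    by (intro compact_imp_bounded compact_continuous_image compact_Times
        continuous_on_subset[OF continuous_on_quadratic_form[OF \<Omega>_cont]]) auto
  then obtain BQ where "\<forall>p\<in>cball 0 K' \<times> cball 0 Ku. norm (snd p \<bullet> (\<Omega> (fst p) *v snd p)) \<le> BQ"
    unfolding bounded_iff by blast
  then have BQ: "norm (u m \<bullet> (\<Omega> (W m) *v u m)) \<le> BQ" for m
    using W_norm[of m] Ku[of m] by (auto dest: bspec[of _ _ "(W m, u m)"])
  have e_lim: "e \<longlonglongrightarrow> 0"
  proof -
    have "(\<lambda>m. (w m ^ (kF - p))\<^sup>2 *\<^sub>R (u m \<bullet> (\<Omega> (W m) *v u m))) \<longlonglongrightarrow> 0"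
      by (rule bounded_imp_tendsto_zero_scaleR[OF _ BQ])
        (use tendsto_power[OF tendsto_power[OF w_lim, of "kF - p"], of 2] p in \<open>simp add: power_0_left\<close>)
    then show ?thesis by (simp add: e_def[abs_def])
  qed
  have key: "(u m \<bullet> u m)\<^sup>2 \<le> e m * F_type_statistic R r \<beta> \<Omega> {} (y m)" for m
  proof -
    let ?v = "R *v \<beta> (y m) - r"
    have "(?v \<bullet> ?v)\<^sup>2 \<le> (?v \<bullet> (\<Omega> (y m) *v ?v)) * (?v \<bullet> (matrix_inv (\<Omega> (y m)) *v ?v))"
      using psd inv[of m] by (intro psd_inverse_cauchy_schwarz sym) (auto simp: invertible_det_nz)
    also have "?v \<bullet> (matrix_inv (\<Omega> (y m)) *v ?v) = F_type_statistic R r \<beta> \<Omega> {} (y m)"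
      using inv[of m] by (simp add: F_type_statistic_def N_star_def)
    also have "?v \<bullet> (\<Omega> (y m) *v ?v) = (w m ^ p)\<^sup>2 * (w m ^ kF)\<^sup>2 * (u m \<bullet> (\<Omega> (W m) *v u m))"
      unfolding u by (subst y_eq, subst \<Omega>_eq[OF w0(1)])
        (simp add: matrix_vector_mult_scaleR scaleR_matrix_vector_assoc[symmetric] power2_eq_square)
    also have "(w m ^ p)\<^sup>2 * (w m ^ kF)\<^sup>2 * (u m \<bullet> (\<Omega> (W m) *v u m)) = (w m ^ p) ^ 4 * e m"
    proof -
      have "w m ^ kF = w m ^ p * w m ^ (kF - p)" using p by (simp flip: power_add)
      then show ?thesis by (simp add: e_def power_mult_distrib power4_eq_xxxx power2_eq_square)
    qed
    also have "(?v \<bullet> ?v)\<^sup>2 = (w m ^ p) ^ 4 * (u m \<bullet> u m)\<^sup>2"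
      unfolding u by (simp add: power4_eq_xxxx power2_eq_square)
    finally have "(w m ^ p) ^ 4 * (u m \<bullet> u m)\<^sup>2 \<le> (w m ^ p) ^ 4 * (e m * F_type_statistic R r \<beta> \<Omega> {} (y m))"
      by (simp add: mult.assoc)
    then show ?thesis using w_pos[of m] by (simp del: power_mult)
  qed
  \<comment> \<open>The comparison stays multiplied by \<open>e m\<close>, so \<open>e m = 0\<close>
    requires no case of its own.\<close>
  have "(\<lambda>m. (u m \<bullet> u m)\<^sup>2 - e m * (\<bar>C\<bar> + 1)) \<longlonglongrightarrow> ((a0 *\<^sub>R column i R) \<bullet> (a0 *\<^sub>R column i R))\<^sup>2 - 0 * (\<bar>C\<bar> + 1)"
    by (intro tendsto_intros u_lim e_lim)
  moreover have "0 < ((a0 *\<^sub>R column i R) \<bullet> (a0 *\<^sub>R column i R))\<^sup>2 - 0 * (\<bar>C\<bar> + 1)"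
    using a0 i(2) by simp
  ultimately have "\<forall>\<^sub>F m in sequentially. 0 < (u m \<bullet> u m)\<^sup>2 - e m * (\<bar>C\<bar> + 1)"
    by (rule order_tendstoD)
  then show ?thesis
  proof (rule eventually_mono)
    fix m assume *: "0 < (u m \<bullet> u m)\<^sup>2 - e m * (\<bar>C\<bar> + 1)"
    show "C \<le> F_type_statistic R r \<beta> \<Omega> {} (y m)"
    proof (rule ccontr)
      assume "\<not> C \<le> F_type_statistic R r \<beta> \<Omega> {} (y m)"
      then have "e m * F_type_statistic R r \<beta> \<Omega> {} (y m) \<le> e m * (\<bar>C\<bar> + 1)"
        using e_nonneg by (intro mult_left_mono) auto
      then show False using key[of m] * by linarith
    qed
  qed
qed

section \<open>Measurability and null sets\<close>

lemma continuous_on_det: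
  fixes A :: "'a::topological_space \<Rightarrow> real ^ 'q ^ 'q"
  assumes "\<And>i j. continuous_on S (\<lambda>y. A y $ i $ j)"
  shows "continuous_on S (\<lambda>y. det (A y))"
  unfolding det_def by (intro continuous_intros assms)

text \<open>By Cramer's rule the statistic is a sum of quotients of continuous functions where the
  determinant is nonzero. This bypasses \<open>matrix_inv\<close>, which is defined by
  choice.\<close>

lemma F_type_statistic_measurable:
  fixes \<Omega> :: "real ^ 'n \<Rightarrow> real ^ 'q ^ 'q"
  assumes \<beta>: "continuous_on UNIV \<beta>" and \<Omega>: "continuous_on UNIV \<Omega>"
  shows "F_type_statistic R r \<beta> \<Omega> {} \<in> borel_measurable borel"
proof -
  define v where "v y = R *v \<beta> y - r" for y
  define N where "N k y = det (\<chi> i j. if j = k then v y $ i else \<Omega> y $ i $ j)" for k y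
  have v_cont: "continuous_on UNIV v"
    unfolding v_def
    by (intro continuous_intros continuous_on_compose2[OF matrix_vector_mult_linear_continuous_on \<beta>]) auto
  have N_cont: "continuous_on UNIV (N k)" for k
    unfolding N_def
  proof (rule continuous_on_det)
    fix i j show "continuous_on UNIV (\<lambda>y. (\<chi> i j. if j = k then v y $ i else \<Omega> y $ i $ j) $ i $ j)"
      by (cases "j = k") (auto intro!: continuous_intros v_cont \<Omega>)
  qed
  have det_cont: "continuous_on UNIV (\<lambda>y. det (\<Omega> y))"
    by (intro continuous_on_det continuous_intros \<Omega>)
  have [measurable]: "N k \<in> borel_measurable borel" for k by (rule borel_measurable_continuous_onI[OF N_cont])
  have [measurable]: "(\<lambda>y. det (\<Omega> y)) \<in> borel_measurable borel" by (rule borel_measurable_continuous_onI[OF det_cont])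
  have [measurable]: "(\<lambda>y. v y $ k) \<in> borel_measurable borel" for k
    by (intro borel_measurable_continuous_onI continuous_intros v_cont)
  have "F_type_statistic R r \<beta> \<Omega> {} y = (if det (\<Omega> y) = 0 then 0 else \<Sum>k\<in>UNIV. v y $ k * (N k y / det (\<Omega> y)))" for y
  proof (cases "det (\<Omega> y) = 0")
    case False
    then have "\<Omega> y *v (matrix_inv (\<Omega> y) *v v y) = v y"
      by (simp add: matrix_vector_mul_assoc mult_matrix_inv invertible_det_nz)
    then have "matrix_inv (\<Omega> y) *v v y = (\<chi> k. N k y / det (\<Omega> y))"
      using cramer[OF False] by (simp add: N_def)
    then show ?thesis using False
      by (simp add: F_type_statistic_def N_star_def v_def[symmetric] inner_vec_def)
  qed (simp add: F_type_statistic_def N_star_def)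
  then have "F_type_statistic R r \<beta> \<Omega> {} = (\<lambda>y. if det (\<Omega> y) = 0 then 0 else \<Sum>k\<in>UNIV. v y $ k * (N k y / det (\<Omega> y)))"
    by (rule ext)
  also have "\<dots> \<in> borel_measurable borel" by measurable
  finally show ?thesis .
qed

definition gauss_factor :: "real ^ 'n ^ 'n \<Rightarrow> real ^ 'n ^ 'n" where
  "gauss_factor A = (SOME B. B ** transpose B = A)"

lemma affine_measurable [measurable]:
  fixes B :: "real ^ 'n ^ 'n"
  shows "(\<lambda>z. \<mu> + B *v (\<chi> i. z i)) \<in> std_gauss \<rightarrow>\<^sub>M (borel :: (real ^ 'n) measure)"
proof -
  have "(\<lambda>v. \<mu> + B *v v) \<in> (borel :: (real ^ 'n) measure) \<rightarrow>\<^sub>M borel"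
    by (intro borel_measurable_continuous_onI continuous_intros matrix_vector_mult_linear_continuous_on)
  from measurable_compose[OF measurable_vec_lambda this] show ?thesis by measurable
qed

lemma gaussian_measure_eq:
  "gaussian_measure \<mu> A = distr std_gauss borel (\<lambda>z. \<mu> + gauss_factor A *v (\<chi> i. z i))"
  by (simp add: gaussian_measure_def std_gauss_def gauss_factor_def Let_def)

lemma prob_space_gaussian_measure: "prob_space (gaussian_measure \<mu> A)"
  unfolding gaussian_measure_eq by (intro prob_space.prob_space_distr prob_space_std_gauss affine_measurable)

text \<open>The preimage lies in the image under the inverse affine map, and differentiable maps of
  a space into itself preserve null sets.\<close>

lemma negligible_affine_preimage:
  fixes B :: "real ^ 'n ^ 'n"
  assumes "invertible B" "negligible S"
  shows "negligible {x. \<mu> + B *v x \<in> S}"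
proof -
  obtain B' where B': "B' ** B = mat 1" using assms(1) by (auto simp: invertible_def)
  have "negligible ((*v) B' ` (+) (- \<mu>) ` S)"
    by (intro negligible_differentiable_image_negligible negligible_translation assms(2)
        linear_imp_differentiable_on matrix_vector_mul_linear order_refl)
  moreover have "{x. \<mu> + B *v x \<in> S} \<subseteq> (*v) B' ` (+) (- \<mu>) ` S"
  proof
    fix x assume "x \<in> {x. \<mu> + B *v x \<in> S}"
    then have "x = B' *v (- \<mu> + (\<mu> + B *v x))" "\<mu> + B *v x \<in> S"
      by (simp_all add: matrix_vector_mul_assoc B')
    then show "x \<in> (*v) B' ` (+) (- \<mu>) ` S" by blast
  qed
  ultimately show ?thesis by (rule negligible_subset)
qed

lemma AE_lebesgue_imp_negligible:
  assumes "AE x in lebesgue. P (x :: 'a::euclidean_space)"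
  shows "negligible {x. \<not> P x}"
proof -
  obtain N where "{x. \<not> P x} \<subseteq> N" "N \<in> null_sets lebesgue"
    using assms by (auto simp: eventually_ae_filter)
  then show ?thesis using negligible_subset negligible_iff_null_sets by blast
qed

lemma AE_std_gauss_det_nonzero:
  fixes B :: "real ^ 'n::finite ^ 'n::finite"
  assumes "AE y in lebesgue. invertible (\<Omega> y :: real ^ 'q ^ 'q)" "invertible B"
  shows "AE z in std_gauss. det (\<Omega> (\<mu> + B *v (\<chi> i. z i))) \<noteq> 0"
proof -
  have "AE z in std_gauss. (\<chi> i. z i) \<notin> {x. \<mu> + B *v x \<in> {y. \<not> invertible (\<Omega> y)}}"
    by (intro AE_std_gauss_not_in_negligible negligible_affine_preimage AE_lebesgue_imp_negligible assms)
  then show ?thesis by (rule eventually_mono) (simp add: invertible_det_nz)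
qed

section \<open>Roots of nearly degenerate covariance matrices\<close>

text \<open>This norm depends on the product \<open>B ** transpose B\<close> alone, so it is known
  whichever root was chosen.\<close>

lemma norm_transpose_mult_sq:
  fixes B :: "real ^ 'm ^ 'n"
  shows "(norm (transpose B *v x))\<^sup>2 = (\<Sum>i\<in>UNIV. \<Sum>j\<in>UNIV. x $ i * x $ j * (B ** transpose B) $ i $ j)"
proof -
  have "(norm (transpose B *v x))\<^sup>2 = x \<bullet> ((B ** transpose B) *v x)"
    by (simp only: power2_norm_eq_inner matrix_vector_mul_assoc[symmetric])
      (metis dot_lmul_matrix transpose_matrix_vector transpose_transpose)
  then show ?thesis
    by (simp add: inner_vec_def matrix_vector_mult_def sum_distrib_left mult_ac)
qed

text \<open>The limiting quadratic form sees a vector only through its pairings with cosine and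
  sine. For a nearby covariance, \<open>transpose B\<close> therefore makes vectors with vanishing
  pairings small, which expresses each row of \<open>B\<close> through the images of two fixed
  vectors.\<close>

lemma ar2_covariance_factor_approx:
  fixes w s \<epsilon> :: real
  assumes w: "0 < w" "w \<le> 1" and "0 < s" "0 < \<epsilon>" and card: "2 \<le> CARD('n::{finite,linorder})"
  obtains a1 a2 where "\<And>x. 0 < ar2_poly a1 a2 x"
    and "\<And>B :: real ^ 'n::{finite,linorder} ^ 'n::{finite,linorder}.
      B ** transpose B = s *\<^sub>R Sigma_mat (restrict (ar2_density a1 a2) {-pi..pi}) \<Longrightarrow>
      \<exists>d1 d2. s / 4 \<le> (norm d1)\<^sup>2 \<and> (norm d1)\<^sup>2 \<le> 4 * s \<and> s / 4 \<le> (norm d2)\<^sup>2 \<and> (norm d2)\<^sup>2 \<le> 4 * s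
        \<and> (\<forall>t. norm (row t B - (cos (w * pos t) *\<^sub>R d1 + sin (w * pos t) *\<^sub>R d2)) \<le> \<epsilon>)"
proof -
  \<comment> \<open>Tends to 1 while keeping \<open>1 - \<rho> m \<le> w\<close>, as the mass bound
    requires.\<close>
  define \<rho> where "\<rho> m = 1 - w / real (Suc m)" for m
  have wm: "0 < w / real (Suc m)" "w / real (Suc m) \<le> w" for m
    using w by (auto simp: divide_le_eq mult_le_cancel_left1)
  have \<rho>: "0 \<le> \<rho> m" "\<rho> m < 1" "1 - \<rho> m \<le> w" for m
    using wm[of m] w unfolding \<rho>_def by linarith+
  have wpi: "w \<le> pi" using w pi_gt3 by linarith
  define g where "g m h = ar2_cov (2 * \<rho> m * cos w) (- (\<rho> m)\<^sup>2) h" for m h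
  have g_lim: "(\<lambda>m. g m h) \<longlonglongrightarrow> cos (of_int h * w)" for h
  proof (rule Lim_null[THEN iffD2], rule tendsto_rabs_zero_cancel, rule tendsto_sandwich[of "\<lambda>_. 0"])
    show "\<forall>\<^sub>F m in sequentially. \<bar>g m h - cos (of_int h * w)\<bar> \<le> 3 ^ nat \<bar>h\<bar> * ((1 + 64 * pi) * sqrt (w / real (Suc m)))"
      using ar2_cov_approx[OF \<rho> wpi] by (intro always_eventually allI) (simp add: g_def \<rho>_def)
    have "(\<lambda>m. w / real (Suc m)) \<longlonglongrightarrow> 0"
      using LIMSEQ_Suc[OF lim_const_over_n[of w]] by simp
    then have "(\<lambda>m. 3 ^ nat \<bar>h\<bar> * ((1 + 64 * pi) * sqrt (w / real (Suc m)))) \<longlonglongrightarrow> 3 ^ nat \<bar>h\<bar> * ((1 + 64 * pi) * sqrt 0)"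
      by (intro tendsto_intros)
    then show "(\<lambda>m. 3 ^ nat \<bar>h\<bar> * ((1 + 64 * pi) * sqrt (w / real (Suc m)))) \<longlonglongrightarrow> 0" by simp
  qed auto
  define Q where "Q m x = (\<Sum>i\<in>UNIV. \<Sum>j\<in>UNIV. x $ i * x $ j * g m (int (pos i) - int (pos j)))" for m and x :: "real ^ 'n::{finite,linorder}"
  define cc where "cc x = (\<Sum>i\<in>UNIV. x $ i * cos (w * pos i))" for x :: "real ^ 'n::{finite,linorder}"
  define ss where "ss x = (\<Sum>i\<in>UNIV. x $ i * sin (w * pos i))" for x :: "real ^ 'n::{finite,linorder}"
  have Q_lim: "(\<lambda>m. Q m x) \<longlonglongrightarrow> (cc x)\<^sup>2 + (ss x)\<^sup>2" for x
  proof -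
    have "(\<lambda>m. Q m x) \<longlonglongrightarrow> (\<Sum>i\<in>UNIV. \<Sum>j\<in>UNIV. x $ i * x $ j * cos (of_int (int (pos i) - int (pos j)) * w))"
      unfolding Q_def by (intro tendsto_intros g_lim)
    also have "(\<Sum>i\<in>UNIV. \<Sum>j\<in>UNIV. x $ i * x $ j * cos (of_int (int (pos i) - int (pos j)) * w))
       = (\<Sum>i\<in>UNIV. \<Sum>j\<in>UNIV. (x $ i * cos (w * pos i)) * (x $ j * cos (w * pos j))
        + (x $ i * sin (w * pos i)) * (x $ j * sin (w * pos j)))"
      by (intro sum.cong refl) (simp add: left_diff_distrib cos_diff algebra_simps)
    also have "\<dots> = (cc x)\<^sup>2 + (ss x)\<^sup>2"
      by (simp add: cc_def ss_def power2_eq_square sum_product sum.distrib)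
    finally show ?thesis .
  qed
  obtain t1 :: "'n::{finite,linorder}" where t1: "pos t1 = 1"
    by (rule obtain_pos[of 1]) (use card in auto)
  obtain t2 :: "'n::{finite,linorder}" where t2: "pos t2 = 2"
    by (rule obtain_pos[of 2]) (use card in auto)
  note t = t1 t2
  have sw: "0 < sin w" using w wpi pi_gt3 by (intro sin_gt_zero) linarith+
  \<comment> \<open>Dual to the two harmonics: the pairings are 1, 0 for \<open>x1\<close> and 0, 1
    for \<open>x2\<close>. Times 1 and 2 suffice, as the determinant of the harmonics there is
    \<open>sin w\<close>; this is where two observations are needed.\<close>
  define x1 where "x1 = (1 / sin w) *\<^sub>R (sin (2 * w) *\<^sub>R axis t1 1 - sin w *\<^sub>R axis t2 (1::real))"
  define x2 where "x2 = (1 / sin w) *\<^sub>R (cos w *\<^sub>R axis t2 1 - cos (2 * w) *\<^sub>R axis t1 (1::real))"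
  \<comment> \<open>\<open>transpose B *v er t\<close> is row \<open>t\<close> of the root minus its
    harmonic approximation; both pairings of \<open>er t\<close> vanish.\<close>
  define er where "er t = axis t 1 - (cos (w * pos t) *\<^sub>R x1 + sin (w * pos t) *\<^sub>R x2)" for t
  have lin: "cc (x + y) = cc x + cc y" "cc (x - y) = cc x - cc y" "cc (a *\<^sub>R x) = a * cc x" "cc (axis i 1) = cos (w * pos i)"
     "ss (x + y) = ss x + ss y" "ss (x - y) = ss x - ss y" "ss (a *\<^sub>R x) = a * ss x" "ss (axis i 1) = sin (w * pos i)"
    for x y a i
    by (simp_all add: cc_def ss_def axis_def algebra_simps sum.distrib sum_subtractf sum_distrib_left if_distrib if_distribR cong: if_cong)
  have sd: "sin (2 * w) * cos w - sin w * cos (2 * w) = sin w" "cos w * sin (2 * w) - cos (2 * w) * sin w = sin w"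
    using sin_diff[of "2 * w" w] by (simp_all add: mult.commute)
  have x1: "cc x1 = 1" "ss x1 = 0" and x2: "cc x2 = 0" "ss x2 = 1"
    using sw sd by (simp_all add: x1_def x2_def lin t mult.commute[of w])
  have er: "cc (er t) = 0" "ss (er t) = 0" for t
    by (simp_all add: er_def lin x1 x2)
  have L: "(\<lambda>m. Q m x1) \<longlonglongrightarrow> 1" "(\<lambda>m. Q m x2) \<longlonglongrightarrow> 1"
    using Q_lim[of x1] Q_lim[of x2] by (simp_all add: x1 x2)
  \<comment> \<open>The factors \<open>1 / 4\<close> and 4 are slack around the limit 1.\<close>
  have "\<forall>\<^sub>F m in sequentially. 1 / 4 < Q m x1" "\<forall>\<^sub>F m in sequentially. 1 / 4 < Q m x2"
    by (rule order_tendstoD(1)[OF L(1)], simp) (rule order_tendstoD(1)[OF L(2)], simp)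
  moreover have "\<forall>\<^sub>F m in sequentially. Q m x1 < 4" "\<forall>\<^sub>F m in sequentially. Q m x2 < 4"
    by (rule order_tendstoD(2)[OF L(1)], simp) (rule order_tendstoD(2)[OF L(2)], simp)
  moreover have "\<forall>\<^sub>F m in sequentially. \<forall>t. Q m (er t) < \<epsilon>\<^sup>2 / s"
  proof (rule eventually_all_finite)
    fix t
    have "0 < \<epsilon>\<^sup>2 / s" using assms by simp
    then show "\<forall>\<^sub>F m in sequentially. Q m (er t) < \<epsilon>\<^sup>2 / s"
      using Q_lim[of "er t"] by (intro order_tendstoD(2)[of _ 0]) (simp_all add: er)
  qed
  ultimately have "\<forall>\<^sub>F m in sequentially. 1 / 4 < Q m x1 \<and> Q m x1 < 4 \<and> 1 / 4 < Q m x2 \<and> Q m x2 < 4 \<and> (\<forall>t. Q m (er t) < \<epsilon>\<^sup>2 / s)"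
    by eventually_elim simp
  then obtain m where m: "1 / 4 < Q m x1" "Q m x1 < 4" "1 / 4 < Q m x2" "Q m x2 < 4" "\<And>t. Q m (er t) < \<epsilon>\<^sup>2 / s"
    by (metis (no_types, lifting) eventually_sequentially order_refl)
  note P = ar2_poly_pos[OF \<rho>(1,2), of m w]
  show thesis
  proof (rule that[OF P])
    fix B :: "real ^ 'n::{finite,linorder} ^ 'n::{finite,linorder}"
    assume B: "B ** transpose B = s *\<^sub>R Sigma_mat (restrict (ar2_density (2 * \<rho> m * cos w) (- (\<rho> m)\<^sup>2)) {-pi..pi})"
    have nQ: "(norm (transpose B *v x))\<^sup>2 = s * Q m x" for x
      unfolding norm_transpose_mult_sq B vector_scaleR_component Sigma_mat_ar2[OF P] Q_def g_def
      by (simp add: sum_distrib_left mult_ac)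
    have r: "row t B - (cos (w * pos t) *\<^sub>R (transpose B *v x1) + sin (w * pos t) *\<^sub>R (transpose B *v x2)) = transpose B *v er t" for t
    proof -
      have "row t B = transpose B *v axis t 1"
        by (simp add: matrix_vector_mult_basis column_transpose del: transpose_matrix_vector)
      then show ?thesis
        by (simp add: er_def matrix_vector_mult_diff_distrib matrix_vector_right_distrib matrix_vector_mult_scaleR del: transpose_matrix_vector)
    qed
    have "norm (transpose B *v er t) \<le> \<epsilon>" for t
    proof (rule power2_le_imp_le)
      show "(norm (transpose B *v er t))\<^sup>2 \<le> \<epsilon>\<^sup>2"
        unfolding nQ using m(5)[of t] \<open>0 < s\<close> by (simp add: pos_less_divide_eq mult.commute)
    qed (use \<open>0 < \<epsilon>\<close> in simp)
    then have close: "\<forall>t. norm (row t B - (cos (w * pos t) *\<^sub>R (transpose B *v x1) + sin (w * pos t) *\<^sub>R (transpose B *v x2))) \<le> \<epsilon>"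
      unfolding r by blast
    have "s / 4 \<le> (norm (transpose B *v x))\<^sup>2 \<and> (norm (transpose B *v x))\<^sup>2 \<le> 4 * s"
      if "1 / 4 < Q m x" "Q m x < 4" for x
      using that mult_left_mono[of "1 / 4" "Q m x" s] mult_left_mono[of "Q m x" 4 s] \<open>0 < s\<close>
      unfolding nQ by simp
    note bounds = this[OF m(1,2)] this[OF m(3,4)]
    show "\<exists>d1 d2. s / 4 \<le> (norm d1)\<^sup>2 \<and> (norm d1)\<^sup>2 \<le> 4 * s \<and> s / 4 \<le> (norm d2)\<^sup>2 \<and> (norm d2)\<^sup>2 \<le> 4 * s
        \<and> (\<forall>t. norm (row t B - (cos (w * pos t) *\<^sub>R d1 + sin (w * pos t) *\<^sub>R d2)) \<le> \<epsilon>)"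
      using bounds close by blast
  qed
qed

lemma AE_std_gauss_inner_nonzero:
  assumes "d \<noteq> 0"
  shows "AE z in std_gauss. d \<bullet> (\<chi> i. z i) \<noteq> 0"
  using AE_std_gauss_not_in_negligible[OF negligible_hyperplane, of d 0] assms by simp

section \<open>Subsequence limit and supremum\<close>

theorem theorem5p1:
  fixes X :: "real ^ 'k::{finite,linorder} ^ 'n::{finite,linorder}"
    and R :: "real ^ 'k::{finite,linorder} ^ 'q"
    and r :: "real ^ 'q"
    and kF :: nat
    and \<FF> :: "(real \<Rightarrow> real) set"
    and \<beta> :: "real ^ 'n::{finite,linorder} \<Rightarrow> real ^ 'k::{finite,linorder}"
    and \<Omega> :: "real ^ 'n::{finite,linorder} \<Rightarrow> real ^ 'q ^ 'q"
    and C \<sigma>2 :: real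
    and \<mu>0 :: "real ^ 'n::{finite,linorder}"
  assumes "CARD('k) < CARD('n)"
    and "rank X = CARD('k)"
    and "rank R = CARD('q)"
    and "\<FF> \<subseteq> F_all"
    and "F_AR2 \<subseteq> \<FF>"
    and "polynomial_trend X R kF"
    and "estimator_conditions X \<beta> \<Omega> {}"
    and "\<forall>y v. 0 \<le> v \<bullet> (\<Omega> y *v v)"
    and "\<mu>0 \<in> M0 X R r"
    and "0 < \<sigma>2"
  shows "(SUP f\<in>\<FF>. measure (gaussian_measure \<mu>0 (\<sigma>2 *\<^sub>R Sigma_mat f))
            {y. F_type_statistic R r \<beta> \<Omega> {} y \<ge> C}) = 1"
proof -
  let ?T = "F_type_statistic R r \<beta> \<Omega> {}"
  let ?p = "\<lambda>f. measure (gaussian_measure \<mu>0 (\<sigma>2 *\<^sub>R Sigma_mat f)) {y. ?T y \<ge> C}"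
  from assms(7) have cont: "continuous_on UNIV \<beta>" "continuous_on UNIV \<Omega>"
    and inv: "AE y in lebesgue. invertible (\<Omega> y)"
    unfolding estimator_conditions_def by auto
  note [measurable] = F_type_statistic_measurable[OF cont, of R r]
  have card: "2 \<le> CARD('n)" using assms(1) zero_less_card_finite[where 'a='k] by linarith

  define w :: "nat \<Rightarrow> real" where "w m = 1 / real (Suc m)" for m
  have w: "0 < w m" "w m \<le> 1" for m by (simp_all add: w_def)
  have w_lim: "w \<longlonglongrightarrow> 0" unfolding w_def using LIMSEQ_inverse_real_of_nat by (simp add: inverse_eq_divide)

  \<comment> \<open>The tolerance \<open>w m ^ kF\<close> has the order of the Taylor remainder, so
    replacing the rows by harmonics does not dominate it.\<close>
  have "\<exists>f \<in> F_AR2. \<exists>d1 d2. invertible (gauss_factor (\<sigma>2 *\<^sub>R Sigma_mat f) :: real ^ 'n::{finite,linorder} ^ 'n::{finite,linorder})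
     \<and> \<sigma>2 / 4 \<le> (norm d1)\<^sup>2 \<and> (norm d1)\<^sup>2 \<le> 4 * \<sigma>2 \<and> \<sigma>2 / 4 \<le> (norm d2)\<^sup>2 \<and> (norm d2)\<^sup>2 \<le> 4 * \<sigma>2
     \<and> (\<forall>t. norm (row t (gauss_factor (\<sigma>2 *\<^sub>R Sigma_mat f) :: real ^ 'n::{finite,linorder} ^ 'n::{finite,linorder}) - (cos (w m * pos t) *\<^sub>R d1 + sin (w m * pos t) *\<^sub>R d2)) \<le> w m ^ kF)" for m
  proof -
    have "0 < w m ^ kF" using w[of m] by simp
    from w[of m] assms(10) this card obtain a1 a2 where P: "\<And>x. 0 < ar2_poly a1 a2 x"
      and approx: "\<And>B :: real ^ 'n::{finite,linorder} ^ 'n::{finite,linorder}.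
      B ** transpose B = \<sigma>2 *\<^sub>R Sigma_mat (restrict (ar2_density a1 a2) {-pi..pi}) \<Longrightarrow>
      \<exists>d1 d2. \<sigma>2 / 4 \<le> (norm d1)\<^sup>2 \<and> (norm d1)\<^sup>2 \<le> 4 * \<sigma>2 \<and> \<sigma>2 / 4 \<le> (norm d2)\<^sup>2 \<and> (norm d2)\<^sup>2 \<le> 4 * \<sigma>2
        \<and> (\<forall>t. norm (row t B - (cos (w m * pos t) *\<^sub>R d1 + sin (w m * pos t) *\<^sub>R d2)) \<le> w m ^ kF)"
      by (rule ar2_covariance_factor_approx[where 'n='n]) blast
    let ?f = "restrict (ar2_density a1 a2) {-pi..pi}"
    let ?B = "gauss_factor (\<sigma>2 *\<^sub>R Sigma_mat ?f) :: real ^ 'n::{finite,linorder} ^ 'n::{finite,linorder}"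
    have B: "?B ** transpose ?B = \<sigma>2 *\<^sub>R Sigma_mat ?f"
      unfolding gauss_factor_def by (rule someI_ex[OF Sigma_mat_ar2_factor[OF P assms(10)]])
    show ?thesis
      using ar2_density_in_F_AR2[OF P] Sigma_mat_ar2_factor_invertible[OF P assms(10) B] approx[OF B] by blast
  qed
  then obtain f d1 d2 where f: "\<And>m. f m \<in> F_AR2"
    and Binv: "\<And>m. invertible (gauss_factor (\<sigma>2 *\<^sub>R Sigma_mat (f m)) :: real ^ 'n::{finite,linorder} ^ 'n::{finite,linorder})"
    and d: "\<And>m. \<sigma>2 / 4 \<le> (norm (d1 m))\<^sup>2" "\<And>m. (norm (d1 m))\<^sup>2 \<le> 4 * \<sigma>2"
      "\<And>m. \<sigma>2 / 4 \<le> (norm (d2 m))\<^sup>2" "\<And>m. (norm (d2 m))\<^sup>2 \<le> 4 * \<sigma>2"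
    and rows: "\<And>m t. norm (row t (gauss_factor (\<sigma>2 *\<^sub>R Sigma_mat (f m)) :: real ^ 'n::{finite,linorder} ^ 'n::{finite,linorder})
        - (cos (w m * pos t) *\<^sub>R d1 m + sin (w m * pos t) *\<^sub>R d2 m)) \<le> w m ^ kF"
    by metis
  define B where "B m = (gauss_factor (\<sigma>2 *\<^sub>R Sigma_mat (f m)) :: real ^ 'n::{finite,linorder} ^ 'n::{finite,linorder})" for m

  \<comment> \<open>The directions come from an arbitrary root and need not converge; bounded norms
    provide a convergent subsequence.\<close>
  have "norm (d1 m) \<le> sqrt (4 * \<sigma>2)" "norm (d2 m) \<le> sqrt (4 * \<sigma>2)" for m
    using d by (auto intro: real_le_rsqrt)
  then have mem: "\<forall>m. (d1 m, d2 m) \<in> cball 0 (sqrt (4 * \<sigma>2)) \<times> cball 0 (sqrt (4 * \<sigma>2))" by simp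
  have sc: "seq_compact (cball (0 :: real ^ 'n::{finite,linorder}) (sqrt (4 * \<sigma>2)) \<times> cball (0 :: real ^ 'n::{finite,linorder}) (sqrt (4 * \<sigma>2)))"
    by (intro compact_imp_seq_compact compact_Times compact_cball)
  obtain D \<phi> where "D \<in> cball 0 (sqrt (4 * \<sigma>2)) \<times> cball 0 (sqrt (4 * \<sigma>2))"
    and \<phi>: "strict_mono (\<phi> :: nat \<Rightarrow> nat)" and D: "((\<lambda>m. (d1 m, d2 m)) \<circ> \<phi>) \<longlonglongrightarrow> D"
    by (rule seq_compactE[OF sc mem])
  have D1: "(\<lambda>m. d1 (\<phi> m)) \<longlonglongrightarrow> fst D" and D2: "(\<lambda>m. d2 (\<phi> m)) \<longlonglongrightarrow> snd D"
    using tendsto_fst[OF D] tendsto_snd[OF D] by (simp_all add: o_def)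
  \<comment> \<open>The lower bounds pass to the limit, so the limiting amplitudes are nonzero
    almost surely.\<close>
  have "\<sigma>2 / 4 \<le> (norm (fst D))\<^sup>2"
    by (rule LIMSEQ_le_const[OF tendsto_power[OF tendsto_norm[OF D1]]]) (use d in blast)
  moreover have "\<sigma>2 / 4 \<le> (norm (snd D))\<^sup>2"
    by (rule LIMSEQ_le_const[OF tendsto_power[OF tendsto_norm[OF D2]]]) (use d in blast)
  ultimately have D_nz: "fst D \<noteq> 0" "snd D \<noteq> 0" using assms(10) by auto

  \<comment> \<open>One normal vector drives the whole sequence, so the exceptional null sets of all
    \<open>m\<close> combine into one.\<close>
  let ?y = "\<lambda>z m. \<mu>0 + B (\<phi> m) *v (\<chi> i. z i)"
  have "AE z in std_gauss. fst D \<bullet> (\<chi> i. z i) \<noteq> 0" "AE z in std_gauss. snd D \<bullet> (\<chi> i. z i) \<noteq> 0"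
    by (rule AE_std_gauss_inner_nonzero[OF D_nz(1)], rule AE_std_gauss_inner_nonzero[OF D_nz(2)])
  moreover have "AE z in std_gauss. \<forall>m. det (\<Omega> (?y z m)) \<noteq> 0"
    unfolding AE_all_countable B_def by (intro allI AE_std_gauss_det_nonzero inv Binv)
  ultimately have large: "AE z in std_gauss. \<forall>\<^sub>F m in sequentially. C \<le> ?T (?y z m)"
  proof eventually_elim
    case (elim z)
    let ?v = "\<chi> i. z i"
    show ?case
    proof (rule F_type_statistic_eventually_ge[OF assms(6-9),
          where w = "\<lambda>m. w (\<phi> m)" and c = "\<lambda>m. d1 (\<phi> m) \<bullet> ?v" and s = "\<lambda>m. d2 (\<phi> m) \<bullet> ?v" and K = "norm ?v"])
      show "(\<lambda>m. w (\<phi> m)) \<longlonglongrightarrow> 0"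
        using LIMSEQ_subseq_LIMSEQ[OF w_lim \<phi>] by (simp add: o_def)
      show "(\<lambda>m. d1 (\<phi> m) \<bullet> ?v) \<longlonglongrightarrow> fst D \<bullet> ?v" "(\<lambda>m. d2 (\<phi> m) \<bullet> ?v) \<longlonglongrightarrow> snd D \<bullet> ?v"
        by (intro tendsto_intros D1 D2)+
      fix m t
      let ?M = "\<phi> m"
      have "?y z m $ t - \<mu>0 $ t - (d1 ?M \<bullet> ?v * cos (w ?M * pos t) + d2 ?M \<bullet> ?v * sin (w ?M * pos t))
          = (row t (B ?M) - (cos (w ?M * pos t) *\<^sub>R d1 ?M + sin (w ?M * pos t) *\<^sub>R d2 ?M)) \<bullet> ?v"
        by (simp add: inner_simps matrix_vector_mul_component row_def vec_nth_inverse mult.commute)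
      also have "\<bar>\<dots>\<bar> \<le> norm (row t (B ?M) - (cos (w ?M * pos t) *\<^sub>R d1 ?M + sin (w ?M * pos t) *\<^sub>R d2 ?M)) * norm ?v"
        by (rule Cauchy_Schwarz_ineq2)
      also have "\<dots> \<le> w ?M ^ kF * norm ?v"
        using rows[of t ?M] unfolding B_def by (rule mult_right_mono) simp
      finally show "\<bar>?y z m $ t - \<mu>0 $ t - (d1 ?M \<bullet> ?v * cos (w ?M * pos t) + d2 ?M \<bullet> ?v * sin (w ?M * pos t))\<bar>
          \<le> norm ?v * w ?M ^ kF" by (simp add: mult.commute)
    qed (use elim w in auto)
  qed

  interpret G: prob_space "std_gauss :: ('n::{finite,linorder} \<Rightarrow> real) measure" by (rule prob_space_std_gauss)
  \<comment> \<open>On the common source space the probabilities are integrals of indicators that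
    tend to 1 almost surely.\<close>
  have p: "?p (f (\<phi> m)) = (LINT z|std_gauss. indicator {z. C \<le> ?T (?y z m)} z)" for m
  proof -
    have "?p (f (\<phi> m)) = measure std_gauss ((\<lambda>z. ?y z m) -` {y. C \<le> ?T y} \<inter> space std_gauss)"
      unfolding gaussian_measure_eq B_def by (rule measure_distr) measurable
    also have "\<dots> = (LINT z|std_gauss. indicator {z. C \<le> ?T (?y z m)} z)"
      by (simp add: vimage_def Int_def conj_commute)
    finally show ?thesis .
  qed
  have "(\<lambda>m. LINT z|std_gauss. indicator {z. C \<le> ?T (?y z m)} z :: real) \<longlonglongrightarrow> (LINT z|(std_gauss :: ('n::{finite,linorder} \<Rightarrow> real) measure). 1)"
  proof (rule integral_dominated_convergence[where w = "\<lambda>_. 1"])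
    show "(\<lambda>z. indicator {z. C \<le> ?T (?y z m)} z :: real) \<in> borel_measurable std_gauss" for m
      by measurable
    show "AE z in std_gauss. (\<lambda>m. indicator {z. C \<le> ?T (?y z m)} z :: real) \<longlonglongrightarrow> 1"
      using large
    proof eventually_elim
      case (elim z)
      then show ?case by (intro tendsto_eventually) (auto elim: eventually_mono)
    qed
  qed (auto simp: indicator_def)
  then have lim: "(\<lambda>m. ?p (f (\<phi> m))) \<longlonglongrightarrow> 1" unfolding p by (simp add: G.prob_space)

  have le1: "?p g \<le> 1" for g
    by (rule prob_space.prob_le_1[OF prob_space_gaussian_measure])
  then have bdd: "bdd_above (?p ` \<FF>)" by (auto simp: bdd_above_def)
  show ?thesis
  proof (rule antisym)
    show "(SUP g\<in>\<FF>. ?p g) \<le> 1"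
      using f assms(5) le1 by (intro cSUP_least) auto
    show "1 \<le> (SUP g\<in>\<FF>. ?p g)"
      by (rule LIMSEQ_le_const2[OF lim]) (use f assms(5) in \<open>auto intro!: exI[of _ 0] cSUP_upper[OF _ bdd]\<close>)
  qed
qed

end
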